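(* For all integers $n,g\ge 0$, $$A(n,g)=\frac{(2n)!}{2^n\, n!\,(n+1)!}\,\bar{A}(n,g),\qquad\text{where}\qquad \bar{A}(n,g)=\sum_{k=0}^n \binom{n}{k}\sum_{i+j=n+2-2g}C(n-k+1,i)\,(-1)^{k+1-j}\,C(k+1,j),$$ the inner sum being over pairs of non-negative integers $i,j$ with $i+j=n+2-2g$.
   Context: $A(n,g)$ is the number of rooted one-face maps of genus $g$ with $n$ edges, up to equivalence. A rooted one-face map with $n$ edges is encoded as a triple $(\alpha,\beta,\gamma)$ of permutations of $\{1,\dots,2n\}$ where $\alpha$ is an involution without fixed points (its cycles are the edges), $\gamma=(1,2,\dots,2n)$ is the long cycle (the boundary), and $\gamma=\alpha\beta$ (the cycles of $\beta$ are the vertices; products are composed right to left). The root has label $1$. Two triples $(\alpha,\beta,\gamma)$, $(\alpha',\beta',\gamma')$ are equivalent if there is a permutation $\pi$ with $\alpha'=\pi\alpha\pi^{-1}$, $\gamma'=\pi\gamma\pi^{-1}$, $\pi(1)=1$ (since $\gamma=\gamma'=(1,2,\dots,2n)$, this forces $\pi$ to be the identity). The genus $g$ is determined by $v-n+1=2-2g$, where $v$ is the number of cycles of $\beta$. Thus $A(n,g)$ is the number of fixed-point-free involutions $\alpha$ of $\{1,\dots,2n\}$ such that $\alpha^{-1}\gamma$ has exactly $n+1-2g$ cycles. For $n=0$ the only map is the single vertex: $A(0,0)=1$ and $A(0,g)=0$ for $g>0$. $C(m,k)$ denotes the number of permutations of $m$ elements with exactly $k$ cycles (unsigned Stirling numbers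 of the first kind; $C(m,0)=0$ for $m\ge1$). *)

theory Defs
  imports Complex_Main "HOL-Combinatorics.Orbits" "HOL-Combinatorics.Cycles"
begin

(* Fixed points count as cycles (of length 1): the orbit of a fixed point x is {x}. *)
definition num_cycles :: "'a set \<Rightarrow> ('a \<Rightarrow> 'a) \<Rightarrow> nat" where
  "num_cycles S p = card (orbit p ` S)"

(* C(m,k), the unsigned Stirling numbers of the first kind. *)
definition perms_with_cycles :: "nat \<Rightarrow> nat \<Rightarrow> nat" where
  "perms_with_cycles m k = card {p. p permutes {1..m} \<and> num_cycles {1..m} p = k}"

type_synonym triple = "(nat \<Rightarrow> nat) \<times> (nat \<Rightarrow> nat) \<times> (nat \<Rightarrow> nat)"

definition long_cycle :: "nat \<Rightarrow> nat \<Rightarrow> nat" where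
  "long_cycle n = cycle_of_list [1..<2 * n + 1]"

definition rooted_one_face_maps :: "nat \<Rightarrow> triple set" where
  "rooted_one_face_maps n =
    {(\<alpha>, \<beta>, \<gamma>).
       \<alpha> permutes {1..2 * n} \<and> \<beta> permutes {1..2 * n} \<and>
       (\<forall>x\<in>{1..2 * n}. \<alpha> (\<alpha> x) = x \<and> \<alpha> x \<noteq> x) \<and>
       \<gamma> = long_cycle n \<and> \<gamma> = \<alpha> \<circ> \<beta>}"

(* For n = 0 there are no labels, hence no cycles, but the only map is a single vertex. *)
definition num_vertices :: "nat \<Rightarrow> triple \<Rightarrow> nat" where
  "num_vertices n = (\<lambda>(\<alpha>, \<beta>, \<gamma>). if n = 0 then 1 else num_cycles {1..2 * n} \<beta>)"

definition has_genus :: "nat \<Rightarrow> triple \<Rightarrow> nat \<Rightarrow> bool" where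
  "has_genus n M g \<longleftrightarrow> int (num_vertices n M) - int n + 1 = 2 - 2 * int g"

(* Equivalence of triples: relabelling fixing the root label 1. *)
definition map_equiv :: "nat \<Rightarrow> (triple \<times> triple) set" where
  "map_equiv n =
    {((\<alpha>, \<beta>, \<gamma>), (\<alpha>', \<beta>', \<gamma>')).
       (\<alpha>, \<beta>, \<gamma>) \<in> rooted_one_face_maps n \<and> (\<alpha>', \<beta>', \<gamma>') \<in> rooted_one_face_maps n \<and>
       (\<exists>\<pi>. \<pi> permutes {1..2 * n} \<and> \<pi> 1 = 1 \<and>
            \<alpha>' = \<pi> \<circ> \<alpha> \<circ> inv \<pi> \<and> \<gamma>' = \<pi> \<circ> \<gamma> \<circ> inv \<pi>)}"

definition A :: "nat \<Rightarrow> nat \<Rightarrow> nat" where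
  "A n g = card ({M \<in> rooted_one_face_maps n. has_genus n M g} // map_equiv n)"

(* The condition on i + j is stated over the integers, since n + 2 - 2 g may be negative
   (the inner sum is then empty).  The exponent k + 1 - j is an integer as well; where it is
   negative, the factor C(k+1,j) vanishes. *)
definition A_bar :: "nat \<Rightarrow> nat \<Rightarrow> real" where
  "A_bar n g =
    (\<Sum>k=0..n. real (n choose k) *
       (\<Sum>(i, j) \<in> {(i, j). int i + int j = int n + 2 - 2 * int g}.
          real (perms_with_cycles (n - k + 1) i) * (-1) powi (int k + 1 - int j) *
          real (perms_with_cycles (k + 1) j)))"

end

(* For a permutation t of a finite set U with a point r, the alternating sum of (-1)^cyc(t|S) over all
   t-invariant subsets S of U - {r} is 1 if t is a single cycle and 0 otherwise. Hence, for a perfect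
   matching a of U, the sum of x^cyc(a t) over all single cycles t is a sum over subsets S of signed
   sums over Sym(S) x Sym(U - S). Such a term vanishes when a leads out of S from two or more points;
   otherwise it splits into rising and falling factorials, up to one merging of two cycles. What
   remains is a binomial sum. Since all long cycles are conjugate, summing over all matchings
   instead fixes the long cycle, and comparing coefficients of x gives the theorem. *)
theory Submission
  imports Defs "HOL-Computational_Algebra.Polynomial"
begin

section \<open>Counting cycles\<close>

text \<open>A sum over single cycles does not factor, while a sum over a full symmetric group does;
  the indicator trades the one for the other. The point r stays outside S because over all subsets
  of a nonempty U the alternating sum would be (1 - 1)^cyc = 0 for every t. What makes the terms
  computable is that (-1)^cyc(t|S) is the sign of t on S up to (-1)^|S|. A sign is multiplicative,
  so the parts of the matching that respect S and U - S can be absorbed into the summation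
  variables, and two edges leading out of S allow a sign-reversing conjugation. In the language of
  characters, the sign on Sym(S) times the trivial character on Sym(U - S) induces a sum of at most
  two hook characters, and only hooks are nonzero on a long cycle. Keeping r out of S singles out
  its edge among all edges, which is why the evaluation consists of three sums that have to be
  recombined.\<close>

lemma orbit_eq_iff:
  assumes "p permutes S" "finite S"
  shows "orbit p x = orbit p y \<longleftrightarrow> x \<in> orbit p y"
  using assms cyclic_on_orbit orbit_cyclic_eq3 permutation_self_in_orbit permutes_imp_permutation
  by metis

lemma num_cycles_cong:
  assumes "\<And>x. x \<in> S \<Longrightarrow> p x = q x" "\<And>x. x \<in> S \<Longrightarrow> p x \<in> S"
  shows "num_cycles S p = num_cycles S q"
proof -
  have "orbit p x = orbit q x" if "x \<in> S" for x
    using that assms by (intro orbit_cong0[of x S]) auto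
  then have "orbit p ` S = orbit q ` S" by (intro image_cong) auto
  then show ?thesis by (simp add: num_cycles_def)
qed

lemma num_cycles_Un_disjoint:
  assumes "finite S" "finite T" "S \<inter> T = {}"
    and "\<And>x. x \<in> S \<Longrightarrow> p x \<in> S" "\<And>x. x \<in> T \<Longrightarrow> p x \<in> T"
  shows "num_cycles (S \<union> T) p = num_cycles S p + num_cycles T p"
proof -
  have sub: "orbit p x \<subseteq> V" if "x \<in> V" "\<And>x. x \<in> V \<Longrightarrow> p x \<in> V" for x V
  proof
    fix y assume "y \<in> orbit p x" then show "y \<in> V" by induct (use that in auto)
  qed
  have "orbit p x \<noteq> orbit p y" if "x \<in> S" "y \<in> T" for x y
    using sub[OF that(1) assms(4)] sub[OF that(2) assms(5)] assms(3) orbit_nonempty[of p x] by blast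
  then have "orbit p ` S \<inter> orbit p ` T = {}" by blast
  then show ?thesis
    unfolding num_cycles_def image_Un using assms by (intro card_Un_disjoint) auto
qed

lemma num_cycles_conj:
  assumes "q permutes S"
  shows "num_cycles S (q \<circ> p \<circ> inv q) = num_cycles S p"
proof -
  have orb: "orbit (q \<circ> p \<circ> inv q) (q x) = q ` orbit p x" for x
  proof -
    have "((q \<circ> p \<circ> inv q) ^^ n) (q x) = q ((p ^^ n) x)" for n
      by (induction n) (auto simp: permutes_inverses[OF assms])
    then show ?thesis by (auto simp: orbit_altdef)
  qed
  have "orbit (q \<circ> p \<circ> inv q) ` S = orbit (q \<circ> p \<circ> inv q) ` q ` S"
    by (simp add: permutes_image[OF assms])
  also have "\<dots> = (\<lambda>X. q ` X) ` (orbit p ` S)"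
    by (simp add: image_image orb)
  finally show ?thesis
    unfolding num_cycles_def using permutes_inj[OF assms]
    by (simp add: card_image inj_on_def inj_image_eq_iff)
qed

text \<open>\<open>transpose a b \<circ> p\<close> runs along the \<open>p\<close>-cycle of
  \<open>a\<close> up to the point that \<open>p\<close> would send back to \<open>a\<close>; that
  point goes to \<open>b\<close> instead, and the cycle of \<open>b\<close> is led back to
  \<open>a\<close> in the same way.\<close>

lemma orbit_transpose_comp:
  assumes "p permutes S" "finite S" "a \<in> S" "b \<in> S" "b \<notin> orbit p a"
  shows "orbit (transpose a b \<circ> p) a = orbit p a \<union> orbit p b"
proof -
  define p' where "p' = transpose a b \<circ> p"
  have p': "p' permutes S"
    unfolding p'_def using assms by (intro permutes_compose permutes_swap_id)
  have self: "x \<in> orbit p x" "x \<in> orbit p' x" for x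
    using assms p' permutation_self_in_orbit permutes_imp_permutation by metis+
  have "a \<notin> orbit p b" using assms orbit_eq_iff self by metis
  have half: "orbit p c \<subseteq> orbit p' c"
    if c: "{c, d} = {a, b}" "d \<notin> orbit p c" for c d
  proof
    fix y assume "y \<in> orbit p c"
    \<comment> \<open>Membership in \<open>orbit p c\<close> is carried along because it excludes
      \<open>p y = d\<close>. The transposition then matters only at the return to \<open>c\<close>,
      where nothing is left to show.\<close>
    then have "y \<in> orbit p' c \<and> y \<in> orbit p c"
    proof induct
      case base
      show ?case
      proof (cases "p c = c")
        case True then show ?thesis using self by metis
      next
        case False
        then have "p' c = p c" using c orbit.base[of p c]
          by (auto simp: p'_def doubleton_eq_iff transpose_def)
        then show ?thesis by (metis orbit.base)
      qed
    next
      case (step y)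
      show ?case
      proof (cases "p y = c")
        case True then show ?thesis using self by metis
      next
        case False
        moreover have "p y \<noteq> d" using c step orbit.step by metis
        ultimately have "p' y = p y" using c
          by (auto simp: p'_def doubleton_eq_iff transpose_def)
        then show ?thesis using step by (metis orbit.step)
      qed
    qed
    then show "y \<in> orbit p' c" by simp
  qed
  have A: "orbit p a \<subseteq> orbit p' a" and B: "orbit p b \<subseteq> orbit p' b"
    using half[of a b] half[of b a] assms \<open>a \<notin> orbit p b\<close> by auto
  \<comment> \<open>The predecessor of \<open>a\<close> is the link between the two cycles:
    \<open>p'\<close> sends it to \<open>b\<close>.\<close>
  have "inv p a \<in> orbit p a"
    using assms orbit_eq_iff[of p S] self(1) by (metis orbit.base permutes_inverses(1))
  then have "p' (inv p a) \<in> orbit p' a" using A by (auto intro: orbit.step)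
  then have "b \<in> orbit p' a" by (simp add: p'_def permutes_inverses[OF assms(1)])
  then have "orbit p' b = orbit p' a" using orbit_eq_iff p' assms(2) by metis
  then have "orbit p a \<union> orbit p b \<subseteq> orbit p' a" using A B by simp
  moreover have "orbit p' a \<subseteq> orbit p a \<union> orbit p b"
  proof
    fix y assume "y \<in> orbit p' a"
    then show "y \<in> orbit p a \<union> orbit p b"
    proof induct
      case base
      then show ?case using self orbit.base[of p a] by (auto simp: p'_def transpose_def)
    next
      case (step y)
      then have "p y \<in> orbit p a \<union> orbit p b" by (auto intro: orbit.step)
      then show ?case using self by (auto simp: p'_def transpose_def)
    qed
  qed
  ultimately show ?thesis by (auto simp: p'_def)
qed

lemma num_cycles_transpose_comp:
  assumes "p permutes S" "finite S" "a \<in> S" "b \<in> S" "b \<notin> orbit p a"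
  shows "num_cycles S p = Suc (num_cycles S (transpose a b \<circ> p))"
proof -
  define p' where "p' = transpose a b \<circ> p"
  have p': "p' permutes S"
    unfolding p'_def using assms by (intro permutes_compose permutes_swap_id)
  have self: "x \<in> orbit p x" for x
    using assms permutation_self_in_orbit permutes_imp_permutation by metis
  note eq = orbit_eq_iff[OF assms(1,2)] and eq' = orbit_eq_iff[OF p' assms(2)]
  have U: "orbit p' a = orbit p a \<union> orbit p b"
    unfolding p'_def by (rule orbit_transpose_comp[OF assms])
  have in': "orbit p' x = orbit p' a" if "x \<in> orbit p a \<union> orbit p b" for x
    using that U eq' by blast
  have out: "orbit p' x = orbit p x" if "x \<notin> orbit p a \<union> orbit p b" for x
  proof (rule orbit_cong[OF self])
    fix s assume "s \<in> orbit p x"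
    then have "p s \<in> orbit p x" by (rule orbit.step)
    moreover have "a \<notin> orbit p x" "b \<notin> orbit p x" using that eq self by blast+
    ultimately show "p' s = p s" by (auto simp: p'_def transpose_def)
  qed
  \<comment> \<open>On \<open>V\<close> the orbits of \<open>p\<close> and \<open>p'\<close>
    coincide, so only two orbits against one merged orbit remain to be compared.\<close>
  define V where "V = S - (orbit p a \<union> orbit p b)"
  have S: "S = V \<union> (orbit p a \<union> orbit p b)"
    unfolding V_def using permutes_orbit_subset[OF assms(1)] assms by auto
  have 1: "orbit p ` S = insert (orbit p a) (insert (orbit p b) (orbit p ` V))"
    (is "?L = ?R")
  proof -
    have "orbit p ` orbit p a = {orbit p a}" "orbit p ` orbit p b = {orbit p b}"
      using self eq by blast+
    then show ?thesis by (subst S) (simp add: image_Un insert_commute)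
  qed
  have 2: "orbit p' ` S = insert (orbit p' a) (orbit p ` V)"
  proof -
    have "orbit p' ` (orbit p a \<union> orbit p b) = {orbit p' a}"
      using in' self by blast
    moreover have "orbit p' ` V = orbit p ` V" using out by (auto simp: V_def)
    ultimately show ?thesis by (subst S) (simp add: image_Un del: Un_iff)
  qed
  have "orbit p a \<noteq> orbit p b" "orbit p a \<notin> orbit p ` V" "orbit p b \<notin> orbit p ` V"
    using self assms(5) unfolding V_def by blast+
  moreover have "orbit p' a \<notin> orbit p ` V"
    using self U unfolding V_def by blast
  moreover have "finite V" using assms(2) by (simp add: V_def)
  ultimately show ?thesis
    unfolding num_cycles_def p'_def[symmetric] 1 2 by simp
qed

lemma num_cycles_insert_fixpoint:
  assumes "p permutes S" "finite S" "a \<notin> S"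
  shows "num_cycles (insert a S) p = Suc (num_cycles S p)"
proof -
  have "p a = a" using assms(1,3) by (rule permutes_not_in)
  then have "num_cycles {a} p = 1" by (simp add: num_cycles_def)
  then show ?thesis
    using num_cycles_Un_disjoint[of "{a}" S p] assms(2,3) \<open>p a = a\<close> permutes_in_image[OF assms(1)]
    by auto
qed

text \<open>The fixed point \<open>a\<close> is a cycle of its own, and the transposition merges it
  into the cycle of \<open>b\<close>.\<close>

lemma num_cycles_insert_transpose:
  assumes "p permutes S" "finite S" "a \<notin> S" "b \<in> S"
  shows "num_cycles (insert a S) (transpose a b \<circ> p) = num_cycles S p"
proof -
  have "orbit p a = {a}" using permutes_not_in[OF assms(1,3)] by (simp add: orbit_eq_singleton_iff)
  then have "b \<notin> orbit p a" using assms by auto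
  then have "num_cycles (insert a S) p = Suc (num_cycles (insert a S) (transpose a b \<circ> p))"
    using assms permutes_imp_permutes_insert[OF assms(1)] by (intro num_cycles_transpose_comp) auto
  then show ?thesis using num_cycles_insert_fixpoint[OF assms(1-3)] by simp
qed

text \<open>Every permutation of \<open>insert a S\<close> is \<open>transpose a b \<circ> q\<close>
  with \<open>q\<close> permuting \<open>S\<close>. For \<open>b = a\<close> the size and the cycle
  count both grow by one; otherwise only the size grows, and the sign flips.\<close>

lemma sign_num_cycles:
  assumes "finite S" "p permutes S"
  shows "sign p = (-1) ^ (card S + num_cycles S p)"
  using assms
proof (induction S arbitrary: p)
  case empty
  then show ?case by (simp add: num_cycles_def)
next
  case (insert a S)
  from insert.prems have "p \<in> {p. p permutes insert a S}" by simp
  then obtain b q where p: "p = transpose a b \<circ> q" "b \<in> insert a S" "q permutes S"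
    unfolding permutes_insert by auto
  have "sign p = sign (transpose a b) * sign q"
    unfolding p(1) using p insert by (intro sign_compose permutation_swap_id permutes_imp_permutation)
  also have "\<dots> = (if b = a then 1 else -1) * (-1) ^ (card S + num_cycles S q)"
    using insert.IH[OF p(3)] by (auto simp: sign_swap_id)
  also have "\<dots> = (-1) ^ (card (insert a S) + num_cycles (insert a S) p)"
    using p insert by (auto simp: num_cycles_insert_transpose num_cycles_insert_fixpoint)
  finally show ?case .
qed

text \<open>A new point either forms its own cycle, with a factor x, or enters an existing cycle in
  one of \<open>card S\<close> ways; this is the factor x + \<open>card S\<close> of the rising
  factorial.\<close>

lemma sum_power_num_cycles:
  fixes x :: "'a::comm_semiring_1"
  assumes "finite S"
  shows "(\<Sum>p | p permutes S. x ^ num_cycles S p) = pochhammer x (card S)"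
  using assms
proof (induction S)
  case empty
  then show ?case by (simp add: num_cycles_def)
next
  case (insert a S)
  have "(\<Sum>p | p permutes insert a S. x ^ num_cycles (insert a S) p) =
      (\<Sum>b\<in>insert a S. \<Sum>q | q permutes S. x ^ num_cycles (insert a S) (transpose a b \<circ> q))"
    by (rule sum_over_permutations_insert) (use insert in auto)
  also have "\<dots> = (\<Sum>q | q permutes S. x ^ num_cycles (insert a S) q) +
      (\<Sum>b\<in>S. \<Sum>q | q permutes S. x ^ num_cycles S q)"
    using insert by (simp add: num_cycles_insert_transpose)
  also have "(\<Sum>q | q permutes S. x ^ num_cycles (insert a S) q) = x * pochhammer x (card S)"
    using insert by (simp add: num_cycles_insert_fixpoint flip: sum_distrib_left)
  also have "(\<Sum>b\<in>S. \<Sum>q | q permutes S. x ^ num_cycles S q) = of_nat (card S) * pochhammer x (card S)"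
    using insert by simp
  finally show ?case using insert by (simp add: pochhammer_Suc algebra_simps)
qed

lemma sum_sign_power_num_cycles:
  fixes x :: "'a::comm_ring_1"
  assumes "finite S"
  shows "(\<Sum>p | p permutes S. of_int (sign p) * x ^ num_cycles S p) =
    (-1) ^ card S * pochhammer (- x) (card S)"
proof -
  have "(\<Sum>p | p permutes S. of_int (sign p) * x ^ num_cycles S p) =
    (\<Sum>p | p permutes S. (-1) ^ card S * (- x) ^ num_cycles S p)"
  proof (intro sum.cong refl)
    fix p assume "p \<in> {p. p permutes S}"
    then show "of_int (sign p) * x ^ num_cycles S p = (-1) ^ card S * (- x) ^ num_cycles S p"
      by (subst power_minus) (simp add: sign_num_cycles[OF assms] power_add algebra_simps)
  qed
  then show ?thesis using sum_power_num_cycles[OF assms, of "- x"]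
    by (simp flip: sum_distrib_left)
qed

section \<open>Invariant subsets of a permutation\<close>

lemma sum_Pow_card:
  fixes f :: "nat \<Rightarrow> 'a::comm_semiring_1"
  assumes "finite X"
  shows "(\<Sum>C\<in>Pow X. f (card C)) = (\<Sum>k\<le>card X. of_nat (card X choose k) * f k)"
proof -
  have "(\<Sum>C\<in>Pow X. f (card C)) = (\<Sum>k\<le>card X. \<Sum>C\<in>{C\<in>Pow X. card C = k}. f (card C))"
    using assms by (intro sum.group[symmetric]) (auto simp: card_mono)
  also have "\<dots> = (\<Sum>k\<le>card X. of_nat (card X choose k) * f k)"
    by (intro sum.cong refl) (simp add: n_subsets[OF assms])
  finally show ?thesis .
qed

lemma orbit_subset_invariant:
  assumes "p ` S = S" "x \<in> S"
  shows "orbit p x \<subseteq> S"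
proof
  fix y assume "y \<in> orbit p x"
  then show "y \<in> S" by induct (use assms in auto)
qed

lemma Union_orbits_invariant:
  assumes "p permutes U" "finite U" "p ` S = S"
  shows "\<Union> (orbit p ` S) = S"
proof -
  have "x \<in> orbit p x" for x
    using assms permutation_self_in_orbit permutes_imp_permutation by metis
  then show ?thesis using orbit_subset_invariant[OF assms(3)] by blast
qed

text \<open>An invariant set is a union of cycles, so the invariant subsets of \<open>T\<close>
  correspond to the sets of cycles in \<open>T\<close>, and \<open>num_cycles S p\<close> is the
  size of such a set.\<close>

lemma sum_invariant_subsets:
  fixes f :: "nat \<Rightarrow> 'a::comm_semiring_1"
  assumes p: "p permutes U" and fin: "finite U" and T: "p ` T = T" "T \<subseteq> U"
  shows "(\<Sum>S | S \<subseteq> T \<and> p ` S = S. f (num_cycles S p)) =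
    (\<Sum>k\<le>num_cycles T p. of_nat (num_cycles T p choose k) * f k)"
proof -
  have self: "x \<in> orbit p x" for x
    using assms permutation_self_in_orbit permutes_imp_permutation by metis
  note eq = orbit_eq_iff[OF p fin]
  have orbit_image: "p ` orbit p x = orbit p x" for x
  proof
    show "p ` orbit p x \<subseteq> orbit p x" by (auto intro: orbit.step)
    show "orbit p x \<subseteq> p ` orbit p x"
    proof
      fix y assume "y \<in> orbit p x"
      then show "y \<in> p ` orbit p x" by induct (use self in auto)
    qed
  qed
  have orbits: "orbit p ` \<Union> C = C" if "C \<subseteq> orbit p ` T" for C
  proof -
    have "orbit p ` X = {X}" if X: "X \<in> C" for X
    proof -
      obtain x where "X = orbit p x" using X \<open>C \<subseteq> orbit p ` T\<close> by blast
      then show ?thesis using eq[of _ x] self[of x] by auto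
    qed
    then show ?thesis by (auto simp: image_Union)
  qed
  have "(\<Sum>S | S \<subseteq> T \<and> p ` S = S. f (num_cycles S p)) = (\<Sum>C\<in>Pow (orbit p ` T). f (card C))"
  proof (rule sum.reindex_bij_witness[where i = "\<lambda>C. \<Union> C" and j = "\<lambda>S. orbit p ` S"])
    fix S assume "S \<in> {S. S \<subseteq> T \<and> p ` S = S}"
    then have S: "S \<subseteq> T" "p ` S = S" by auto
    show "\<Union> (orbit p ` S) = S" by (rule Union_orbits_invariant[OF p fin S(2)])
    show "orbit p ` S \<in> Pow (orbit p ` T)" using S by auto
    show "f (card (orbit p ` S)) = f (num_cycles S p)" by (simp add: num_cycles_def)
  next
    fix C assume "C \<in> Pow (orbit p ` T)"
    then have C: "C \<subseteq> orbit p ` T" by simp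
    then show "orbit p ` \<Union> C = C" by (rule orbits)
    have "\<Union> C \<subseteq> \<Union> (orbit p ` T)" using C by blast
    moreover have "p ` X = X" if "X \<in> C" for X using C that orbit_image by auto
    ultimately show "\<Union> C \<in> {S. S \<subseteq> T \<and> p ` S = S}"
      using Union_orbits_invariant[OF p fin T(1)] by (auto simp: image_Union)
  qed
  also have "\<dots> = (\<Sum>k\<le>num_cycles T p. of_nat (num_cycles T p choose k) * f k)"
    using finite_subset[OF T(2) fin] by (simp add: sum_Pow_card num_cycles_def)
  finally show ?thesis .
qed

text \<open>An invariant set that avoids \<open>r\<close> avoids the whole cycle of
  \<open>r\<close>, so S is any union of the other cycles and the sum is (1 - 1)^(number of other
  cycles). By 0^0 = 1 it is 1 exactly when there are none.\<close>

lemma cyclic_indicator: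
  fixes U :: "'a set"
  assumes p: "p permutes U" and fin: "finite U" and r: "r \<in> U"
  shows "(\<Sum>S | S \<subseteq> U - {r} \<and> p ` S = S. (-1) ^ num_cycles S p) =
    (if orbit p r = U then 1 else (0::'b::comm_ring_1))"
proof -
  define T where "T = U - orbit p r"
  have self: "x \<in> orbit p x" for x
    using assms permutation_self_in_orbit permutes_imp_permutation by metis
  note eq = orbit_eq_iff[OF p fin]
  have "p x \<in> orbit p r \<longleftrightarrow> x \<in> orbit p r" for x
    using eq permutation_orbit_step[OF permutes_imp_permutation[OF fin p], of x] by metis
  then have "p ` T \<subseteq> T" using permutes_in_image[OF p] by (auto simp: T_def)
  moreover have "finite T" using fin by (simp add: T_def)
  ultimately have pT: "p ` T = T"
    using endo_inj_surj permutes_inj_on[OF p] by metis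
  have "{S. S \<subseteq> U - {r} \<and> p ` S = S} = {S. S \<subseteq> T \<and> p ` S = S}"
  proof -
    have "S \<subseteq> U - {r} \<longleftrightarrow> S \<subseteq> T" if "p ` S = S" for S
    proof
      assume S: "S \<subseteq> U - {r}"
      have "x \<notin> orbit p r" if "x \<in> S" for x
        using orbit_subset_invariant[OF \<open>p ` S = S\<close> that] S eq self by blast
      then show "S \<subseteq> T" using S by (auto simp: T_def)
    qed (use self in \<open>auto simp: T_def\<close>)
    then show ?thesis by blast
  qed
  then have "(\<Sum>S | S \<subseteq> U - {r} \<and> p ` S = S. (-1) ^ num_cycles S p) =
      (\<Sum>k\<le>num_cycles T p. of_nat (num_cycles T p choose k) * (-1) ^ k :: 'b)"
    using sum_invariant_subsets[OF p fin pT, of "\<lambda>k. (-1) ^ k"] by (simp add: T_def)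
  also have "\<dots> = ((-1) + 1) ^ num_cycles T p"
    by (subst binomial_ring) simp
  also have "num_cycles T p = 0 \<longleftrightarrow> orbit p r = U"
    using \<open>finite T\<close> permutes_orbit_subset[OF p r] by (auto simp: num_cycles_def T_def)
  then have "((-1) + 1) ^ num_cycles T p = (if orbit p r = U then 1 else (0::'b))"
    by (auto simp: power_0_left)
  finally show ?thesis .
qed

text \<open>By injectivity a permutation of \<open>U\<close> that maps \<open>S\<close> onto itself
  also preserves \<open>U - S\<close>, so it is the product of its two restrictions, each extended
  by the identity.\<close>

lemma sum_permutes_invariant:
  assumes "S \<subseteq> U" "finite U"
  shows "(\<Sum>t | t permutes U \<and> t ` S = S. f t) =
    (\<Sum>p | p permutes S. \<Sum>q | q permutes (U - S). f (p \<circ> q))"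
proof -
  have "(\<Sum>t | t permutes U \<and> t ` S = S. f t) =
    (\<Sum>(p, q) \<in> {p. p permutes S} \<times> {q. q permutes (U - S)}. f (p \<circ> q))"
  proof (rule sum.reindex_bij_witness[where i = "\<lambda>(p, q). p \<circ> q"
        and j = "\<lambda>t. (restrict_id t S, restrict_id t (U - S))"])
    fix t assume "t \<in> {t. t permutes U \<and> t ` S = S}"
    then have t: "t permutes U" "t ` S = S" by auto
    then have tU: "t ` (U - S) = U - S"
      using image_set_diff[OF permutes_inj[OF t(1)], of U S] permutes_image[OF t(1)] by simp
    have "bij_betw t S S" "bij_betw t (U - S) (U - S)"
      using t(2) tU permutes_inj_on[OF t(1)] by (auto simp: bij_betw_def)
    then show "(restrict_id t S, restrict_id t (U - S)) \<in> {p. p permutes S} \<times> {q. q permutes (U - S)}"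
      by (simp add: permutes_restrict_id)
    have "restrict_id t S (restrict_id t (U - S) x) = t x" for x
      using tU assms permutes_not_in[OF t(1), of x]
      by (cases "x \<in> S"; cases "x \<in> U") (auto simp: restrict_id_def)
    then show *: "(case (restrict_id t S, restrict_id t (U - S)) of (p, q) \<Rightarrow> p \<circ> q) = t"
      by (auto simp: fun_eq_iff)
    then show "(case (restrict_id t S, restrict_id t (U - S)) of (p, q) \<Rightarrow> f (p \<circ> q)) = f t"
      by simp
  next
    fix pq assume "pq \<in> {p. p permutes S} \<times> {q. q permutes (U - S)}"
    then obtain p q where pq: "pq = (p, q)" "p permutes S" "q permutes (U - S)" by auto
    have q: "q x = x" if "x \<in> S" for x using pq(3) that by (simp add: permutes_def)
    have p: "p (q x) = q x" if "x \<notin> S" for x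
    proof -
      have "q x \<notin> S" using that pq(3) permutes_in_image[OF pq(3), of x] 
        by (cases "x \<in> U") (auto simp: permutes_def)
      then show ?thesis using pq(2) by (simp add: permutes_def)
    qed
    have "p \<circ> q permutes U"
      using pq assms by (intro permutes_compose) (auto intro: permutes_subset)
    moreover have "(p \<circ> q) ` S = S" using q permutes_image[OF pq(2)] by (simp add: image_comp[symmetric])
    ultimately show "(case pq of (p, q) \<Rightarrow> p \<circ> q) \<in> {t. t permutes U \<and> t ` S = S}"
      by (simp add: pq)
    have "restrict_id (p \<circ> q) S = p"
      using q pq(2) by (auto simp: restrict_id_def fun_eq_iff permutes_def)
    moreover have "restrict_id (p \<circ> q) (U - S) = q"
      using p pq(3) by (auto simp: restrict_id_def fun_eq_iff permutes_def)
    ultimately show "(restrict_id (case pq of (p, q) \<Rightarrow> p \<circ> q) S,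
        restrict_id (case pq of (p, q) \<Rightarrow> p \<circ> q) (U - S)) = pq"
      by (simp add: pq)
  qed
  then show ?thesis by (simp add: sum.cartesian_product)
qed

lemma num_cycles_comp_disjoint:
  assumes "S \<subseteq> U" "finite U" "p permutes S" "q permutes (U - S)"
  shows "num_cycles S (p \<circ> q) = num_cycles S p"
    and "num_cycles U (p \<circ> q) = num_cycles S p + num_cycles (U - S) q"
proof -
  have q: "q x = x" if "x \<in> S" for x using assms(4) that by (simp add: permutes_def)
  have p: "p (q x) = q x" if "x \<in> U - S" for x
    using that permutes_in_image[OF assms(4), of x] assms(3) by (simp add: permutes_def)
  show 1: "num_cycles S (p \<circ> q) = num_cycles S p"
    using q permutes_in_image[OF assms(3)] by (intro num_cycles_cong) auto
  have 2: "num_cycles (U - S) (p \<circ> q) = num_cycles (U - S) q"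
    using p permutes_in_image[OF assms(4)] by (intro num_cycles_cong) auto
  have "num_cycles (S \<union> (U - S)) (p \<circ> q) = num_cycles S (p \<circ> q) + num_cycles (U - S) (p \<circ> q)"
  proof (rule num_cycles_Un_disjoint)
    show "finite S" "finite (U - S)" using assms finite_subset by auto
    show "(p \<circ> q) x \<in> S" if "x \<in> S" for x using that q permutes_in_image[OF assms(3)] by simp
    show "(p \<circ> q) x \<in> U - S" if "x \<in> U - S" for x
      using that p permutes_in_image[OF assms(4), of x] by simp
  qed auto
  moreover have "S \<union> (U - S) = U" using assms by auto
  ultimately show "num_cycles U (p \<circ> q) = num_cycles S p + num_cycles (U - S) q"
    using 1 2 by simp
qed

section \<open>Signed sums over permutations with an invariant subset\<close>

definition matchings :: "'a set \<Rightarrow> ('a \<Rightarrow> 'a) set" where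
  "matchings S = {\<alpha>. \<alpha> permutes S \<and> (\<forall>x\<in>S. \<alpha> (\<alpha> x) = x \<and> \<alpha> x \<noteq> x)}"

lemma matching_orbit:
  assumes "\<alpha> \<in> matchings U" "x \<in> U"
  shows "orbit \<alpha> x = {x, \<alpha> x}"
proof -
  have "(\<alpha> ^^ 2) x = x" using assms by (simp add: matchings_def numeral_2_eq_2)
  then have "orbit \<alpha> x = {(\<alpha> ^^ m) x |m. m < 2}" by (rule orbit_altdef_bounded) simp
  also have "\<dots> = {x, \<alpha> x}" 
    by (auto simp: less_2_cases_iff intro: exI[where x = "0::nat"] exI[where x = "1::nat"])
  finally show ?thesis .
qed

lemma card_invariant_matching:
  assumes \<alpha>: "\<alpha> \<in> matchings U" and fin: "finite U" and T: "T \<subseteq> U" "\<alpha> ` T = T"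
  shows "card T = 2 * num_cycles T \<alpha>"
proof -
  have perm: "\<alpha> permutes U" using \<alpha> by (simp add: matchings_def)
  have 2: "card X = 2" if X: "X \<in> orbit \<alpha> ` T" for X
  proof -
    obtain x where x: "x \<in> T" "X = orbit \<alpha> x" using X by auto
    then have "x \<in> U" using T by auto
    then show ?thesis using matching_orbit[OF \<alpha>, of x] x \<alpha> by (simp add: matchings_def card_2_iff')
  qed
  have "2 * card (orbit \<alpha> ` T) = card (\<Union> (orbit \<alpha> ` T))"
  proof (rule card_partition)
    show "finite (orbit \<alpha> ` T)" using T fin finite_subset by blast
    show "finite (\<Union> (orbit \<alpha> ` T))"
      using Union_orbits_invariant[OF perm fin T(2)] T fin finite_subset by metis
    fix X Y assume "X \<in> orbit \<alpha> ` T" "Y \<in> orbit \<alpha> ` T" "X \<noteq> Y"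
    then show "X \<inter> Y = {}" using orbit_eq_iff[OF perm fin] by blast
  qed (rule 2)
  then show ?thesis using Union_orbits_invariant[OF perm fin T(2)] by (simp add: num_cycles_def)
qed

section \<open>Contributions of the subsets for a fixed matching\<close>

context
  fixes U :: "'a set" and \<alpha> :: "'a \<Rightarrow> 'a" and x :: real
  assumes fin: "finite U" and \<alpha>: "\<alpha> \<in> matchings U"
begin

text \<open>What a fixed \<open>S\<close> contributes after the sums over t and S are exchanged: a t
  preserving \<open>S\<close> is \<open>p \<circ> q\<close>, and the sign from
  \<open>cyclic_indicator\<close> sees only the cycles of \<open>p\<close>.\<close>

definition weight :: "'a set \<Rightarrow> real" where
  "weight S = (\<Sum>p | p permutes S. \<Sum>q | q permutes (U - S).
     (-1) ^ num_cycles S p * x ^ num_cycles U (\<alpha> \<circ> (p \<circ> q)))"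

lemma permutes_matching: "\<alpha> permutes U"
  and matching_invol: "\<alpha> (\<alpha> y) = y"
  and matching_neq: "y \<in> U \<Longrightarrow> \<alpha> y \<noteq> y"
  using \<alpha> by (auto simp: matchings_def permutes_def)

lemma matching_in_iff: "\<alpha> y \<in> U \<longleftrightarrow> y \<in> U"
  by (rule permutes_in_image[OF permutes_matching])

lemma matching_eq_iff: "\<alpha> y = \<alpha> z \<longleftrightarrow> y = z"
  by (metis matching_invol)

text \<open>With \<open>sign p\<close> the summand has a multiplicative sign; both the vanishing
  argument and the substitution that removes the matching rely on it.\<close>

lemma weight_sign:
  assumes "S \<subseteq> U"
  shows "weight S = (-1) ^ card S * (\<Sum>p | p permutes S. \<Sum>q | q permutes (U - S).
     of_int (sign p) * x ^ num_cycles U (\<alpha> \<circ> (p \<circ> q)))"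
proof -
  have "(-1) ^ num_cycles S p = (-1) ^ card S * real_of_int (sign p)" if "p permutes S" for p
    using sign_num_cycles[OF finite_subset[OF assms fin] that]
    by (simp add: power_add)
  then show ?thesis by (simp add: weight_def sum_distrib_left mult.assoc)
qed

text \<open>Conjugating \<^term>\<open>\<alpha> \<circ> \<tau>\<close> by the transposition of \<^term>\<open>\<alpha> a\<close> and \<^term>\<open>\<alpha> b\<close> preserves its
  number of cycles but changes the sign of \<^term>\<open>\<tau>\<close> on \<^term>\<open>S\<close>.\<close>

lemma weight_eq_0:
  assumes S: "S \<subseteq> U" and ab: "a \<in> S" "b \<in> S" "a \<noteq> b" "\<alpha> a \<notin> S" "\<alpha> b \<notin> S"
  shows "weight S = 0"
proof -
  define s where "s = transpose a b"
  define t where "t = transpose (\<alpha> a) (\<alpha> b)"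
  have s: "s permutes S" unfolding s_def using ab by (intro permutes_swap_id)
  have "\<alpha> a \<in> U" "\<alpha> b \<in> U" using ab S matching_in_iff by auto
  then have t: "t permutes (U - S)" unfolding t_def using ab by (intro permutes_swap_id) auto
  have tU: "t permutes U" using t by (rule permutes_subset) auto
  have invs: "s \<circ> (s \<circ> p) = p" "(p \<circ> t) \<circ> t = p" for p :: "'a \<Rightarrow> 'a"
    by (simp_all add: s_def t_def fun_eq_iff)
  \<comment> \<open>Conjugating \<open>\<alpha> \<circ> (p \<circ> q)\<close> by \<open>t\<close>
    thus amounts to replacing \<open>p\<close> by \<open>s \<circ> p\<close> and \<open>q\<close> by
    \<open>q \<circ> t\<close>. The new pair is admissible because \<open>\<alpha> a\<close> and
    \<open>\<alpha> b\<close> both lie outside \<open>S\<close>.\<close>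
  have conj: "\<alpha> \<circ> s = t \<circ> \<alpha>"
    using matching_eq_iff matching_invol by (auto simp: s_def t_def fun_eq_iff transpose_def)
  let ?f = "\<lambda>p q. real_of_int (sign p) * x ^ num_cycles U (\<alpha> \<circ> (p \<circ> q))"
  have f: "?f (s \<circ> p) (q \<circ> t) = - ?f p q" if "p permutes S" for p q
  proof -
    have "sign (s \<circ> p) = sign s * sign p"
      using s that finite_subset[OF S fin] by (intro sign_compose permutes_imp_permutation)
    then have "sign (s \<circ> p) = - sign p" using ab by (simp add: s_def sign_swap_id)
    moreover have "\<alpha> \<circ> ((s \<circ> p) \<circ> (q \<circ> t)) = t \<circ> (\<alpha> \<circ> (p \<circ> q)) \<circ> inv t"
    proof -
      have "inv t = t" by (simp add: t_def)
      then show ?thesis using conj by (simp add: fun_eq_iff)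
    qed
    ultimately show ?thesis using num_cycles_conj[OF tU] by simp
  qed
  have "(\<Sum>p | p permutes S. \<Sum>q | q permutes (U - S). ?f p q) =
      (\<Sum>p | p permutes S. \<Sum>q | q permutes (U - S). ?f (s \<circ> p) (q \<circ> t))"
  proof (rule sum.reindex_bij_witness[where i = "\<lambda>p. s \<circ> p" and j = "\<lambda>p. s \<circ> p"])
    fix p assume p: "p \<in> {p. p permutes S}"
    then show "s \<circ> p \<in> {p. p permutes S}" using s by (simp add: permutes_compose)
    show "s \<circ> (s \<circ> p) = p" by (rule invs)
    show "(\<Sum>q | q permutes (U - S). ?f (s \<circ> (s \<circ> p)) (q \<circ> t)) = (\<Sum>q | q permutes (U - S). ?f p q)"
    proof (rule sum.reindex_bij_witness[where i = "\<lambda>q. q \<circ> t" and j = "\<lambda>q. q \<circ> t"])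
      fix q assume q: "q \<in> {q. q permutes (U - S)}"
      then show "q \<circ> t \<in> {q. q permutes (U - S)}" "q \<circ> t \<in> {q. q permutes (U - S)}"
        using t by (simp_all add: permutes_compose)
    qed (simp_all only: invs)
  qed (auto simp: invs permutes_compose[OF _ s])
  also have "\<dots> = - (\<Sum>p | p permutes S. \<Sum>q | q permutes (U - S). ?f p q)"
    unfolding sum_negf[symmetric] by (intro sum.cong refl) (simp only: f mem_Collect_eq)
  finally show ?thesis using weight_sign[OF S] by simp
qed

text \<open>The factors \<open>\<beta>\<close> and \<open>\<gamma>\<close> of the matching are
  absorbed by substituting \<open>\<beta> \<circ> p\<close> and \<open>\<gamma> \<circ> q\<close>,
  at the price of \<open>sign \<beta>\<close>. In the applications \<open>d\<close> is the identity
  if no edge joins \<open>S\<close> to its complement, and one transposition if a single edge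
  does.\<close>

lemma weight_decompose:
  assumes S: "S \<subseteq> U" and \<beta>: "\<beta> permutes S" and \<gamma>: "\<gamma> permutes (U - S)"
    and eq: "\<alpha> = d \<circ> \<beta> \<circ> \<gamma>"
  shows "weight S = (-1) ^ card S * of_int (sign \<beta>) *
    (\<Sum>p | p permutes S. \<Sum>q | q permutes (U - S). of_int (sign p) * x ^ num_cycles U (d \<circ> (p \<circ> q)))"
proof -
  let ?f = "\<lambda>p q. real_of_int (sign p) * x ^ num_cycles U (\<alpha> \<circ> (p \<circ> q))"
  let ?g = "\<lambda>p q. of_int (sign \<beta>) * (real_of_int (sign p) * x ^ num_cycles U (d \<circ> (p \<circ> q)))"
  have g: "?g (\<beta> \<circ> p) (\<gamma> \<circ> q) = ?f p q" if p: "p permutes S" for p q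
  proof -
    \<comment> \<open>\<open>\<gamma>\<close> and \<open>p\<close> move points of disjoint sets, so
      they commute.\<close>
    have "\<gamma> (p z) = p (\<gamma> z)" for z
    proof (cases "z \<in> S")
      case True
      then show ?thesis using permutes_in_image[OF p, of z] \<gamma> by (simp add: permutes_def)
    next
      case False
      then have "\<gamma> z \<notin> S" using permutes_in_image[OF \<gamma>, of z] \<gamma> by (cases "z \<in> U") (auto simp: permutes_def)
      then show ?thesis using False p by (simp add: permutes_def)
    qed
    then have "d \<circ> ((\<beta> \<circ> p) \<circ> (\<gamma> \<circ> q)) = \<alpha> \<circ> (p \<circ> q)" by (simp add: eq fun_eq_iff)
    moreover have "sign (\<beta> \<circ> p) = sign \<beta> * sign p"
      using \<beta> p finite_subset[OF S fin] by (intro sign_compose permutes_imp_permutation)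
    ultimately show ?thesis by (simp flip: of_int_mult mult.assoc)
  qed
  have "(\<Sum>p | p permutes S. \<Sum>q | q permutes (U - S). ?f p q) =
      (\<Sum>p | p permutes S. \<Sum>q | q permutes (U - S). ?g p q)"
  proof (rule sum.reindex_bij_witness[where j = "\<lambda>p. \<beta> \<circ> p" and i = "\<lambda>p. inv \<beta> \<circ> p"])
    fix p assume p: "p \<in> {p. p permutes S}"
    show "(\<Sum>q | q permutes (U - S). ?g (\<beta> \<circ> p) q) = (\<Sum>q | q permutes (U - S). ?f p q)"
    proof (rule sum.reindex_bij_witness[where i = "\<lambda>q. \<gamma> \<circ> q" and j = "\<lambda>q. inv \<gamma> \<circ> q"])
      fix q assume q: "q \<in> {q. q permutes (U - S)}"
      show "inv \<gamma> \<circ> q \<in> {q. q permutes (U - S)}" 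
        using q permutes_compose[OF _ permutes_inv[OF \<gamma>]] by simp
      have \<gamma>q: "\<gamma> \<circ> (inv \<gamma> \<circ> q) = q" by (simp add: fun_eq_iff permutes_inverses[OF \<gamma>])
      show "?f p (inv \<gamma> \<circ> q) = ?g (\<beta> \<circ> p) q"
        using g[of p "inv \<gamma> \<circ> q"] p unfolding \<gamma>q by simp
    qed (auto simp: fun_eq_iff permutes_inverses[OF \<gamma>] intro: permutes_compose \<gamma>)
  qed (auto simp: fun_eq_iff permutes_inverses[OF \<beta>] intro: permutes_compose \<beta> permutes_inv)
  then show ?thesis using weight_sign[OF S] by (simp add: sum_distrib_left mult.assoc)
qed

lemma sum_sign_power_split:
  assumes S: "S \<subseteq> U"
  shows "(\<Sum>p | p permutes S. \<Sum>q | q permutes (U - S). of_int (sign p) * x ^ num_cycles U (p \<circ> q)) =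
    (-1) ^ card S * pochhammer (- x) (card S) * pochhammer x (card U - card S)"
proof -
  have fS: "finite S" "finite (U - S)" using finite_subset[OF S fin] fin by auto
  have "(\<Sum>p | p permutes S. \<Sum>q | q permutes (U - S). of_int (sign p) * x ^ num_cycles U (p \<circ> q)) =
      (\<Sum>p | p permutes S. of_int (sign p) * x ^ num_cycles S p) *
      (\<Sum>q | q permutes (U - S). x ^ num_cycles (U - S) q)"
    unfolding sum_product
    by (intro sum.cong refl) (simp add: num_cycles_comp_disjoint[OF S fin] power_add)
  then show ?thesis
    using fS S fin by (simp add: sum_sign_power_num_cycles sum_power_num_cycles card_Diff_subset)
qed

text \<open>The signed sum over Sym(S) x Sym(U - S) for k = \<open>card S\<close>, up to (-1)^k. For
  0 < k < \<open>card U\<close> it is, up to sign, x times the product of x + c over the contents c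
  of the hook shape with \<open>card U - k\<close> cells in its first row and k - 1 cells below the
  corner.\<close>

definition hook :: "nat \<Rightarrow> real" where
  "hook k = pochhammer (- x) k * pochhammer x (card U - k)"

lemma sign_restrict_matching:
  assumes "S \<subseteq> U" "\<alpha> ` S = S"
  shows "restrict_id \<alpha> S permutes S" "sign (restrict_id \<alpha> S) = (-1) ^ num_cycles S \<alpha>"
proof -
  have "bij_betw \<alpha> S S" 
    using assms permutes_inj_on[OF permutes_matching] by (simp add: bij_betw_def)
  then show p: "restrict_id \<alpha> S permutes S" by (rule permutes_restrict_id)
  have "num_cycles S \<alpha> = num_cycles S (restrict_id \<alpha> S)"
    using assms by (intro num_cycles_cong) auto
  then have "sign (restrict_id \<alpha> S) = (-1) ^ (card S + num_cycles S \<alpha>)"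
    using sign_num_cycles[OF finite_subset[OF assms(1) fin] p] by simp
  then show "sign (restrict_id \<alpha> S) = (-1) ^ num_cycles S \<alpha>"
    using card_invariant_matching[OF \<alpha> fin assms] by (simp only: power_add power_mult) simp
qed

lemma diff_invariant:
  assumes "S \<subseteq> U" "\<alpha> ` S = S"
  shows "\<alpha> ` (U - S) = U - S"
  using image_set_diff[OF permutes_inj[OF permutes_matching], of U S]
    permutes_image[OF permutes_matching] assms by simp

text \<open>The matching splits along \<open>S\<close>, so \<open>d\<close> is the identity and the
  product of the two generating functions remains. The factors (-1)^\<open>card S\<close> cancel,
  leaving the sign of the matching on \<open>S\<close>.\<close>

lemma weight_invariant:
  assumes S: "S \<subseteq> U" "\<alpha> ` S = S"
  shows "weight S = (-1) ^ num_cycles S \<alpha> * hook (2 * num_cycles S \<alpha>)"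
proof -
  have "restrict_id \<alpha> S (restrict_id \<alpha> (U - S) y) = \<alpha> y" for y
    using diff_invariant[OF S] S permutes_not_in[OF permutes_matching, of y]
    by (cases "y \<in> S"; cases "y \<in> U") (auto simp: restrict_id_def)
  then have "\<alpha> = id \<circ> restrict_id \<alpha> S \<circ> restrict_id \<alpha> (U - S)"
    by (simp add: fun_eq_iff)
  from weight_decompose[OF S(1) sign_restrict_matching(1)[OF S]
      sign_restrict_matching(1)[OF _ diff_invariant[OF S]] this]
  show ?thesis
    using sum_sign_power_split[OF S(1)] sign_restrict_matching(2)[OF S]
      card_invariant_matching[OF \<alpha> fin S]
    by (simp add: hook_def power_add mult_2)
qed

text \<open>Exactly one edge leads out of \<open>insert a T\<close>. Its transposition cannot be
  absorbed and merges two cycles of \<open>p \<circ> q\<close>; the lost factor x is restored on the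
  left.\<close>

lemma weight_insert:
  assumes T: "T \<subseteq> U - {a, \<alpha> a}" "\<alpha> ` T = T" and a: "a \<in> U"
  shows "x * weight (insert a T) = (-1) ^ num_cycles T \<alpha> * hook (Suc (2 * num_cycles T \<alpha>))"
proof -
  define S where "S = insert a T"
  \<comment> \<open>The part of the complement that the matching preserves; \<open>a\<close> and
    \<open>\<alpha> a\<close> are left to \<open>d\<close>.\<close>
  define R where "R = U - S - {\<alpha> a}"
  define d where "d = transpose a (\<alpha> a)"
  have S: "S \<subseteq> U" using T a by (auto simp: S_def)
  have \<alpha>a: "\<alpha> a \<in> U" "\<alpha> a \<noteq> a" "\<alpha> a \<in> U - S" using a T matching_in_iff matching_neq by (auto simp: S_def)
  have TU: "T \<subseteq> U" using T by auto
  have R: "\<alpha> ` R = R"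
  proof -
    have "R = U - (T \<union> {a, \<alpha> a})" using T by (auto simp: R_def S_def)
    moreover have "\<alpha> ` (T \<union> {a, \<alpha> a}) = T \<union> {a, \<alpha> a}"
      using T(2) by (auto simp: image_Un matching_invol)
    ultimately show ?thesis using diff_invariant[of "T \<union> {a, \<alpha> a}"] TU a \<alpha>a by auto
  qed
  have "(d \<circ> restrict_id \<alpha> T \<circ> restrict_id \<alpha> R) y = \<alpha> y" for y
  proof -
    consider "y \<in> T" | "y = a" | "y = \<alpha> a" | "y \<in> R" | "y \<notin> U"
      by (auto simp: R_def S_def)
    then show ?thesis
    proof cases
      case 1
      then have "\<alpha> y \<in> T" "y \<notin> R" using T by (auto simp: R_def S_def)
      moreover have "\<alpha> y \<noteq> a" "\<alpha> y \<noteq> \<alpha> a" using T \<open>\<alpha> y \<in> T\<close> by auto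
      ultimately show ?thesis using 1 by (simp add: d_def)
    next
      case 2
      then have "y \<notin> T" "y \<notin> R" using T by (auto simp: R_def S_def)
      then show ?thesis using 2 by (simp add: d_def)
    next
      case 3
      then have "y \<notin> T" "y \<notin> R" using T by (auto simp: R_def S_def)
      then show ?thesis using 3 by (simp add: d_def matching_invol)
    next
      case 4
      then have "\<alpha> y \<in> R" using R by auto
      moreover have "z \<notin> T \<and> z \<noteq> a \<and> z \<noteq> \<alpha> a" if "z \<in> R" for z using that by (auto simp: R_def S_def)
      ultimately show ?thesis using 4 by (simp add: d_def)
    next
      case 5
      then have "y \<notin> T" "y \<notin> R" "\<alpha> y = y" "y \<noteq> a" "y \<noteq> \<alpha> a"
        using TU a \<alpha>a permutes_not_in[OF permutes_matching, of y] by (auto simp: R_def)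
      then show ?thesis by (simp add: d_def)
    qed
  qed
  then have eq: "\<alpha> = d \<circ> restrict_id \<alpha> T \<circ> restrict_id \<alpha> R" by (simp add: fun_eq_iff)
  have perm: "restrict_id \<alpha> T permutes S" "restrict_id \<alpha> R permutes (U - S)"
  proof -
    show "restrict_id \<alpha> T permutes S"
      using sign_restrict_matching(1)[OF TU T(2)] by (rule permutes_subset) (auto simp: S_def)
    have "R \<subseteq> U" by (auto simp: R_def)
    from sign_restrict_matching(1)[OF this R] show "restrict_id \<alpha> R permutes (U - S)"
      by (rule permutes_subset) (auto simp: R_def)
  qed
  \<comment> \<open>\<open>p \<circ> q\<close> preserves \<open>S\<close>, which contains
    \<open>a\<close> but not \<open>\<alpha> a\<close>, so the transposition joins two different
    cycles.\<close>
  have merge: "x * x ^ num_cycles U (d \<circ> (p \<circ> q)) = x ^ num_cycles U (p \<circ> q)"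
    if p: "p permutes S" and q: "q permutes (U - S)" for p q
  proof -
    have pq: "p \<circ> q permutes U"
      using p q S by (intro permutes_compose) (auto intro: permutes_subset)
    have "(p \<circ> q) ` S = S"
      using q permutes_image[OF p] by (auto simp: permutes_def image_iff)
    then have "orbit (p \<circ> q) a \<subseteq> S" by (rule orbit_subset_invariant) (simp add: S_def)
    then have "\<alpha> a \<notin> orbit (p \<circ> q) a" using \<alpha>a by auto
    from num_cycles_transpose_comp[OF pq fin a \<alpha>a(1) this] show ?thesis by (simp add: d_def)
  qed
  have cS: "card S = Suc (card T)"
    using T finite_subset[OF TU fin] unfolding S_def by (subst card_insert_disjoint) auto
  have "x * weight S = (-1) ^ card S * of_int (sign (restrict_id \<alpha> T)) *
      (\<Sum>p | p permutes S. \<Sum>q | q permutes (U - S).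
         of_int (sign p) * (x * x ^ num_cycles U (d \<circ> (p \<circ> q))))"
    unfolding weight_decompose[OF S perm eq] sum_distrib_left
    by (intro sum.cong refl) (simp add: algebra_simps)
  also have "(\<Sum>p | p permutes S. \<Sum>q | q permutes (U - S).
         of_int (sign p) * (x * x ^ num_cycles U (d \<circ> (p \<circ> q)))) =
      (\<Sum>p | p permutes S. \<Sum>q | q permutes (U - S). of_int (sign p) * x ^ num_cycles U (p \<circ> q))"
    by (intro sum.cong refl) (simp add: merge)
  finally show ?thesis
    unfolding sum_sign_power_split[OF S] sign_restrict_matching(2)[OF TU T(2)]
    unfolding cS card_invariant_matching[OF \<alpha> fin TU T(2)] 
    by (simp add: hook_def S_def)
qed

lemma sum_cyclic_eq_sum_weight:
  assumes r: "r \<in> U"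
  shows "(\<Sum>t | t permutes U \<and> orbit t r = U. x ^ num_cycles U (\<alpha> \<circ> t)) =
    (\<Sum>S\<in>Pow (U - {r}). weight S)"
proof -
  let ?P = "{t. t permutes U}" and ?f = "\<lambda>t S. (-1) ^ num_cycles S t * x ^ num_cycles U (\<alpha> \<circ> t)"
  have fP: "finite ?P" by (rule finite_permutations[OF fin])
  have "(\<Sum>t | t permutes U \<and> orbit t r = U. x ^ num_cycles U (\<alpha> \<circ> t)) =
      (\<Sum>t\<in>?P. if orbit t r = U then x ^ num_cycles U (\<alpha> \<circ> t) else 0)"
    by (subst sum.inter_filter[OF fP, symmetric]) simp
  also have "\<dots> = (\<Sum>t\<in>?P. \<Sum>S | S \<in> Pow (U - {r}) \<and> t ` S = S. ?f t S)"
  proof (intro sum.cong refl)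
    fix t assume "t \<in> ?P"
    then have "t permutes U" by simp
    from cyclic_indicator[OF this fin r, where 'b = real]
    show "(if orbit t r = U then x ^ num_cycles U (\<alpha> \<circ> t) else 0) =
        (\<Sum>S | S \<in> Pow (U - {r}) \<and> t ` S = S. ?f t S)"
      by (simp flip: sum_distrib_right)
  qed
  also have "\<dots> = (\<Sum>S\<in>Pow (U - {r}). \<Sum>t | t \<in> ?P \<and> t ` S = S. ?f t S)"
    using fin by (intro sum.swap_restrict fP) simp
  also have "\<dots> = (\<Sum>S\<in>Pow (U - {r}). weight S)"
  proof (intro sum.cong refl)
    fix S assume "S \<in> Pow (U - {r})"
    then have S: "S \<subseteq> U" by auto
    show "(\<Sum>t | t \<in> ?P \<and> t ` S = S. ?f t S) = weight S"
      unfolding weight_def mem_Collect_eq sum_permutes_invariant[OF S fin]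
      by (intro sum.cong refl) (simp add: num_cycles_comp_disjoint(1)[OF S fin])
  qed
  finally show ?thesis .
qed

text \<open>Apart from the edge of \<open>r\<close> there are m edges. The surviving S are unions of
  j of them; such unions with the point \<open>\<alpha> r\<close> added; and unions of j of m - 1
  edges with one of the 2 m points off the edge of \<open>r\<close> added. For m = 0, where
  \<open>m - 1\<close> is truncated, the factor m removes the last sum.\<close>

lemma sum_weight:
  assumes r: "r \<in> U" and card: "card U = 2 * m + 2"
  shows "x * (\<Sum>S\<in>Pow (U - {r}). weight S) =
    x * (\<Sum>j\<le>m. (m choose j) * ((-1) ^ j * hook (2 * j))) +
    (\<Sum>j\<le>m. (m choose j) * ((-1) ^ j * hook (Suc (2 * j)))) +
    2 * real m * (\<Sum>j\<le>m - 1. (m - 1 choose j) * ((-1) ^ j * hook (Suc (2 * j))))"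
proof -
  define I where "I = {S. S \<subseteq> U - {r} \<and> \<alpha> ` S = S}"
  \<comment> \<open>The union of the edges that remain available once \<open>a\<close> is the point
    whose partner is left out. The edge of \<open>r\<close> is always barred, and for
    \<open>a = r\<close> or \<open>a = \<alpha> r\<close> it is the only one removed.\<close>
  define V where "V a = U - {r, \<alpha> r, a, \<alpha> a}" for a
  define J where "J a = {S. S \<subseteq> V a \<and> \<alpha> ` S = S}" for a
  \<comment> \<open>The sets avoiding \<open>r\<close> with exactly one point whose partner lies
    outside.\<close>
  define L where "L = (\<lambda>(a, T). insert a T) ` (SIGMA a:U - {r}. J a)"
  note inI = matching_in_iff and inv = matching_invol and neq = matching_neq
  have V: "\<alpha> ` V a = V a" "V a \<subseteq> U" if "a \<in> U" for a
  proof -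
    have "\<alpha> ` {r, \<alpha> r, a, \<alpha> a} = {r, \<alpha> r, a, \<alpha> a}" by (auto simp: inv)
    then show "\<alpha> ` V a = V a" unfolding V_def using that r inI by (intro diff_invariant) auto
    show "V a \<subseteq> U" by (auto simp: V_def)
  qed
  have mem: "\<alpha> y \<in> S \<longleftrightarrow> y \<in> S" if "\<alpha> ` S = S" for S y
    using that inv by (metis imageI)
  have "card (V r) = 2 * m"
  proof -
    have "card (V r) = card U - card {r, \<alpha> r}"
      unfolding V_def using r inI by (subst card_Diff_subset[symmetric]) (auto intro: arg_cong[of _ _ card])
    then show ?thesis using card neq[OF r] by simp
  qed
  then have nr: "num_cycles (V r) \<alpha> = m"
    using card_invariant_matching[OF \<alpha> fin V(2,1)] r by simp
  have Vr: "V (\<alpha> r) = V r" by (auto simp: V_def inv)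
  have na: "num_cycles (V a) \<alpha> = m - 1" if "a \<in> V r" for a
  proof -
    have a: "a \<in> U" "a \<noteq> r" "a \<noteq> \<alpha> r" using that by (auto simp: V_def)
    then have "\<alpha> a \<noteq> r" "\<alpha> a \<noteq> \<alpha> r" using inv by metis+
    then have "card {r, \<alpha> r, a, \<alpha> a} = 4"
      using a neq[OF r] neq[OF a(1)] by (simp add: card_insert_if eq_commute)
    moreover have "card (V a) = card U - card {r, \<alpha> r, a, \<alpha> a}"
      unfolding V_def using r a inI by (subst card_Diff_subset) auto
    ultimately have "card (V a) = card U - 4" by simp
    then show ?thesis using card card_invariant_matching[OF \<alpha> fin V(2,1)[OF a(1)]] by simp
  qed
  have I: "I = {S. S \<subseteq> V r \<and> \<alpha> ` S = S}"
    unfolding I_def V_def using mem by blast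
  have sum_I: "(\<Sum>S\<in>I. weight S) = (\<Sum>j\<le>m. (m choose j) * ((-1) ^ j * hook (2 * j)))"
  proof -
    have "(\<Sum>S\<in>I. weight S) = (\<Sum>S\<in>I. (-1) ^ num_cycles S \<alpha> * hook (2 * num_cycles S \<alpha>))"
      by (intro sum.cong refl weight_invariant) (auto simp: I_def)
    then show ?thesis
      unfolding I using sum_invariant_subsets[OF permutes_matching fin V[OF r],
        of "\<lambda>k. (-1) ^ k * hook (2 * k)"] nr by simp
  qed
  have sum_J: "(\<Sum>T\<in>J a. x * weight (insert a T)) =
      (\<Sum>j\<le>num_cycles (V a) \<alpha>. (num_cycles (V a) \<alpha> choose j) * ((-1) ^ j * hook (Suc (2 * j))))"
    if a: "a \<in> U" for a
  proof -
    have "(\<Sum>T\<in>J a. x * weight (insert a T)) =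
        (\<Sum>T\<in>J a. (-1) ^ num_cycles T \<alpha> * hook (Suc (2 * num_cycles T \<alpha>)))"
      by (intro sum.cong refl weight_insert a) (auto simp: J_def V_def)
    then show ?thesis
      unfolding J_def using sum_invariant_subsets[OF permutes_matching fin V[OF a],
        of "\<lambda>k. (-1) ^ k * hook (Suc (2 * k))"] by simp
  qed
  \<comment> \<open>\<open>a\<close> is recovered as the only point of \<open>insert a T\<close>
    whose partner is missing.\<close>
  have inj: "inj_on (\<lambda>(a, T). insert a T) (SIGMA a:U - {r}. J a)"
  proof (rule inj_onI)
    fix u v assume "u \<in> (SIGMA a:U - {r}. J a)" "v \<in> (SIGMA a:U - {r}. J a)"
      and "(case u of (a, T) \<Rightarrow> insert a T) = (case v of (a, T) \<Rightarrow> insert a T)"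
    then obtain a T b T' where uv: "u = (a, T)" "v = (b, T')"
      and *: "T \<in> J a" "T' \<in> J b" "insert a T = insert b T'" "a \<in> U" "b \<in> U"
      by auto
    have T: "a \<notin> T" "\<alpha> a \<notin> T" "\<alpha> ` T = T" "b \<notin> T'" "\<alpha> b \<notin> T'" "\<alpha> ` T' = T'"
      using * by (auto simp: J_def V_def)
    have "a = b"
    proof (rule ccontr)
      assume "a \<noteq> b"
      then have "a \<in> T'" using *(3) by auto
      then have "\<alpha> a \<in> T'" using mem T by blast
      then have "\<alpha> a \<in> insert a T" using *(3) by auto
      then show False using T neq[OF *(4)] by auto
    qed
    then show "u = v" using * T by (auto simp: uv)
  qed
  have "(\<Sum>S\<in>L. x * weight S) = (\<Sum>(a, T)\<in>(SIGMA a:U - {r}. J a). x * weight (insert a T))"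
    unfolding L_def by (subst sum.reindex[OF inj]) (simp add: case_prod_unfold)
  also have "\<dots> = (\<Sum>a\<in>U - {r}. \<Sum>T\<in>J a. x * weight (insert a T))"
    using fin by (intro sum.Sigma[symmetric]) (auto simp: J_def V_def)
  also have "U - {r} = insert (\<alpha> r) (V r)" using r inI neq by (auto simp: V_def)
  also have "(\<Sum>a\<in>insert (\<alpha> r) (V r). \<Sum>T\<in>J a. x * weight (insert a T)) =
      (\<Sum>T\<in>J (\<alpha> r). x * weight (insert (\<alpha> r) T)) + (\<Sum>a\<in>V r. \<Sum>T\<in>J a. x * weight (insert a T))"
    using fin by (intro sum.insert) (auto simp: V_def)
  also have "(\<Sum>a\<in>V r. \<Sum>T\<in>J a. x * weight (insert a T)) =
      (\<Sum>a\<in>V r. \<Sum>j\<le>m - 1. (m - 1 choose j) * ((-1) ^ j * hook (Suc (2 * j))))"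
    by (intro sum.cong refl) (use sum_J na V(2)[OF r] in auto)
  also have "\<dots> = 2 * real m * (\<Sum>j\<le>m - 1. (m - 1 choose j) * ((-1) ^ j * hook (Suc (2 * j))))"
    by (simp add: \<open>card (V r) = 2 * m\<close>)
  finally have sum_L: "(\<Sum>S\<in>L. x * weight S) =
      (\<Sum>j\<le>m. (m choose j) * ((-1) ^ j * hook (Suc (2 * j)))) +
      2 * real m * (\<Sum>j\<le>m - 1. (m - 1 choose j) * ((-1) ^ j * hook (Suc (2 * j))))"
    using sum_J[of "\<alpha> r"] r inI nr Vr by simp
  have IL: "I \<subseteq> Pow (U - {r})" "L \<subseteq> Pow (U - {r})" "I \<inter> L = {}"
  proof -
    show "I \<subseteq> Pow (U - {r})" by (auto simp: I_def)
    show "L \<subseteq> Pow (U - {r})" by (auto simp: L_def J_def V_def)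
    have "\<alpha> ` insert a T \<noteq> insert a T" if "a \<in> U" "T \<in> J a" for a T
      using that neq[of a] by (auto simp: J_def V_def)
    then show "I \<inter> L = {}" by (auto simp: I_def L_def)
  qed
  \<comment> \<open>Such a set has two points with partners outside: if \<open>a\<close> were the
    only one, removing it would leave an invariant set, and S would lie in \<open>L\<close>.\<close>
  have rest: "weight S = 0" if "S \<in> Pow (U - {r}) - (I \<union> L)" for S
  proof -
    have S: "S \<subseteq> U" "r \<notin> S" "\<alpha> ` S \<noteq> S" using that by (auto simp: I_def)
    have "\<exists>a\<in>S. \<alpha> a \<notin> S"
    proof (rule ccontr)
      assume *: "\<not> ?thesis"
      then have "y \<in> \<alpha> ` S" if "y \<in> S" for y using that inv by (metis imageI)
      then show False using * S(3) by blast
    qed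
    then obtain a where a: "a \<in> S" "\<alpha> a \<notin> S" by blast
    have "\<exists>b\<in>S. b \<noteq> a \<and> \<alpha> b \<notin> S"
    proof (rule ccontr)
      assume *: "\<not> ?thesis"
      define T where "T = S - {a}"
      have T: "\<alpha> y \<in> T" if "y \<in> T" for y
        using * a that inv unfolding T_def by (metis Diff_iff singletonD singletonI)
      then have "\<alpha> ` T = T" using inv by (metis imageI image_subsetI subset_antisym subsetI)
      moreover have "\<alpha> r \<notin> T" "\<alpha> a \<notin> T" "T \<subseteq> U" "a \<notin> T" "r \<notin> T"
        using T[of "\<alpha> r"] a S by (auto simp: T_def inv)
      ultimately have "T \<in> J a" by (auto simp: J_def V_def)
      moreover have "S = insert a T" "a \<in> U - {r}" using a S by (auto simp: T_def)
      ultimately have "S \<in> L" by (auto simp: L_def)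
      then show False using that by blast
    qed
    then show ?thesis using weight_eq_0[OF S(1) a(1)] a by metis
  qed
  have "(\<Sum>S\<in>Pow (U - {r}). weight S) = (\<Sum>S\<in>I \<union> L. weight S)"
    using IL rest fin by (intro sum.mono_neutral_right) auto
  also have "\<dots> = (\<Sum>S\<in>I. weight S) + (\<Sum>S\<in>L. weight S)"
    using IL fin by (intro sum.union_disjoint) (auto intro: finite_subset)
  finally show ?thesis
    using sum_L by (simp add: sum_I distrib_left sum_distrib_left)
qed

end

section \<open>Binomial identities\<close>

text \<open>Up to sign the factors are x - k + 1, ..., x and x, ..., x + N - k. Taking one x out of
  the second product, nonempty by the bound on k, leaves a run of N consecutive values.\<close>

lemma pochhammer_hook:
  fixes x :: "'a::field_char_0"
  assumes "k \<le> N"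
  shows "pochhammer (- x) k * pochhammer x (Suc N - k) =
    (-1) ^ k * x * fact N * ((x + of_nat N - of_nat k) gchoose N)"
proof -
  have "pochhammer (x - of_nat k + 1) N = pochhammer (x - of_nat k + 1) k * pochhammer (x + 1) (N - k)"
    using pochhammer_product[OF assms, of "x - of_nat k + 1"] by simp
  moreover have "pochhammer x (Suc N - k) = x * pochhammer (x + 1) (N - k)"
    using assms by (simp add: Suc_diff_le pochhammer_rec)
  moreover have "x + of_nat N - of_nat k - of_nat N + 1 = x - of_nat k + 1" by simp
  ultimately show ?thesis
    by (simp add: pochhammer_minus gbinomial_pochhammer')
qed

text \<open>Pascal's rule, or (1 + E)^(p + 1) = (1 + E)^p (1 + E) for the shift E.\<close>

lemma sum_binomial_Suc:
  fixes f :: "nat \<Rightarrow> 'a::comm_semiring_1"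
  shows "(\<Sum>k\<le>Suc p. of_nat (Suc p choose k) * f k) = (\<Sum>k\<le>p. of_nat (p choose k) * (f k + f (Suc k)))"
proof -
  have "(\<Sum>k\<le>Suc p. of_nat (Suc p choose k) * f k) =
      f 0 + (\<Sum>k\<le>p. of_nat (p choose Suc k) * f (Suc k)) + (\<Sum>k\<le>p. of_nat (p choose k) * f (Suc k))"
    unfolding sum.atMost_Suc_shift by (simp add: distrib_right sum.distrib algebra_simps)
  also have "f 0 + (\<Sum>k\<le>p. of_nat (p choose Suc k) * f (Suc k)) = (\<Sum>k\<le>Suc p. of_nat (p choose k) * f k)"
    unfolding sum.atMost_Suc_shift by simp
  finally show ?thesis by (simp add: distrib_left sum.distrib binomial_eq_0)
qed

text \<open>With the backward shift E in y, the left side is (1 - E^2)^p = (1 - E)^p (1 + E)^p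
  applied to a binomial coefficient; each 1 - E lowers both y and the bottom index by one.\<close>

lemma sum_alternating_gchoose:
  fixes y :: "'a::field_char_0"
  shows "(\<Sum>j\<le>p. of_nat (p choose j) * ((-1) ^ j * (y - of_nat (2 * j) gchoose (M + p)))) =
    (\<Sum>k\<le>p. of_nat (p choose k) * (y - of_nat p - of_nat k gchoose M))"
proof (induction p arbitrary: y M)
  case 0
  then show ?case by simp
next
  case (Suc p)
  let ?s = "\<lambda>y. \<Sum>j\<le>p. of_nat (p choose j) * ((-1) ^ j * (y - of_nat (2 * j) gchoose (M + p)))"
  have diff: "(z gchoose (M + Suc p)) - (z - 2 gchoose (M + Suc p)) =
      (z - 1 gchoose (M + p)) + (z - 2 gchoose (M + p))" for z :: 'a
    using gbinomial_Suc_Suc[of "z - 1" "M + p"] gbinomial_Suc_Suc[of "z - 2" "M + p"] by simp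
  have "(\<Sum>j\<le>Suc p. of_nat (Suc p choose j) * ((-1) ^ j * (y - of_nat (2 * j) gchoose (M + Suc p)))) =
      ?s (y - 1) + ?s (y - 2)"
    unfolding sum_binomial_Suc sum.distrib[symmetric]
  proof (intro sum.cong refl)
    fix j
    show "of_nat (p choose j) * ((-1) ^ j * (y - of_nat (2 * j) gchoose (M + Suc p)) +
        (-1) ^ Suc j * (y - of_nat (2 * Suc j) gchoose (M + Suc p))) =
      of_nat (p choose j) * ((-1) ^ j * (y - 1 - of_nat (2 * j) gchoose (M + p))) +
      of_nat (p choose j) * ((-1) ^ j * (y - 2 - of_nat (2 * j) gchoose (M + p)))"
      (is "?b * (?e * ?A + _ * ?B) = ?b * (?e * ?C) + ?b * (?e * ?D)")
    proof -
      have "?A - ?B = ?C + ?D"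
        using diff[of "y - of_nat (2 * j)"] by (simp add: algebra_simps)
      then have "?b * (?e * (?A - ?B)) = ?b * (?e * (?C + ?D))" by simp
      then show ?thesis by (simp add: algebra_simps)
    qed
  qed
  also have "\<dots> = (\<Sum>k\<le>p. of_nat (p choose k) *
      ((y - of_nat (Suc p) - of_nat k gchoose M) + (y - of_nat (Suc p) - of_nat (Suc k) gchoose M)))"
    unfolding Suc.IH by (simp add: sum.distrib distrib_left algebra_simps)
  also have "\<dots> = (\<Sum>k\<le>Suc p. of_nat (Suc p choose k) * (y - of_nat (Suc p) - of_nat k gchoose M))"
    by (rule sum_binomial_Suc[symmetric])
  finally show ?case .
qed

lemma sum_binomial_absorb_comp:
  fixes f :: "nat \<Rightarrow> real"
  shows "(\<Sum>j\<le>p. real (p choose j) * (real (p - j) * f j)) = p * (\<Sum>j\<le>p - 1. real (p - 1 choose j) * f j)"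
proof (cases p)
  case (Suc q)
  have "(\<Sum>j\<le>p. real (p choose j) * (real (p - j) * f j)) =
      (\<Sum>j\<le>p. real ((p - j) * (p choose j)) * f j)"
    by (simp add: algebra_simps)
  also have "\<dots> = (\<Sum>j\<le>p. real (p * ((p - 1) choose j)) * f j)"
    by (simp only: binomial_absorb_comp)
  also have "\<dots> = (\<Sum>j\<le>q. real p * (real (q choose j) * f j))"
    by (simp add: Suc binomial_eq_0 algebra_simps del: binomial_Suc_Suc)
  finally show ?thesis by (simp only: Suc sum_distrib_left diff_Suc_1)
qed simp

lemma sum_binomial_absorb:
  fixes f :: "nat \<Rightarrow> real"
  shows "(\<Sum>j\<le>p. real (p choose j) * (real j * f j)) = p * (\<Sum>j\<le>p - 1. real (p - 1 choose j) * f (Suc j))"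
proof (cases p)
  case (Suc q)
  have "(\<Sum>j\<le>p. real (p choose j) * (real j * f j)) =
      (\<Sum>j\<le>q. real (Suc j * (p choose Suc j)) * f (Suc j))"
    unfolding Suc sum.atMost_Suc_shift by (simp add: algebra_simps)
  also have "\<dots> = (\<Sum>j\<le>q. real (p * ((p - 1) choose j)) * f (Suc j))"
    by (simp only: binomial_absorption Suc)
  finally show ?thesis by (simp add: Suc sum_distrib_left algebra_simps)
qed simp

text \<open>\<open>B k\<close> is the hook value for \<open>card U\<close> = 2 p + 2, stripped of
  (-1)^k and (2 p + 1)! x; the minus signs come from odd k. Passing to bottom index 2 p + 2 removes
  the coefficient x and leaves alternating sums with step two.\<close>

lemma hook_sum:
  fixes x :: real and p :: nat and B :: "nat \<Rightarrow> real"
  defines "B \<equiv> \<lambda>k::nat. (x + real (2 * p + 1) - real k) gchoose (2 * p + 1)"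
  shows "(\<Sum>j\<le>p. (p choose j) * ((-1) ^ j * (x * B (2 * j)))) -
      (\<Sum>j\<le>p. (p choose j) * ((-1) ^ j * B (Suc (2 * j)))) -
      2 * real p * (\<Sum>j\<le>p - 1. (p - 1 choose j) * ((-1) ^ j * B (Suc (2 * j)))) =
    (\<Sum>k\<le>Suc p. (Suc p choose k) * ((x + real (Suc p) - real k) gchoose (Suc p + 1)))"
proof -
  \<comment> \<open>The argument is real because \<open>D (2 * real j - 1)\<close> occurs with j =
    0.\<close>
  define D where "D k = (x + real (2 * p + 1) - k) gchoose (2 * p + 2)" for k :: real
  have B: "B k = D (real k - 1) - D k" for k
    using gbinomial_Suc_Suc[of "x + real (2 * p + 1) - real k" "2 * p + 1"]
    by (simp add: B_def D_def algebra_simps)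
  \<comment> \<open>Absorption turns (x - k) \<open>B k\<close> into (2 p + 2) \<open>D k\<close>;
    the remaining k \<open>B k\<close> is split by Pascal's rule.\<close>
  have xB: "x * B k = (2 * p + 2 - real k) * D k + k * D (real k - 1)" for k
  proof -
    have "(x - real k) * B k = (2 * p + 2) * D k"
      using gbinomial_mult_1[of "x + real (2 * p + 1) - real k" "2 * p + 1"]
      by (simp add: B_def D_def algebra_simps)
    then show ?thesis by (simp only: B) (simp add: algebra_simps)
  qed
  let ?c = "\<lambda>j f. real (p choose j) * ((-1) ^ j * f)"
  have "(\<Sum>j\<le>p. ?c j (x * B (2 * j))) - (\<Sum>j\<le>p. ?c j (B (Suc (2 * j)))) -
      2 * real p * (\<Sum>j\<le>p - 1. (p - 1 choose j) * ((-1) ^ j * B (Suc (2 * j)))) =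
      (\<Sum>j\<le>p. ?c j (x * B (2 * j))) - (\<Sum>j\<le>p. ?c j (B (Suc (2 * j)))) -
      2 * (\<Sum>j\<le>p. real (p choose j) * (real (p - j) * ((-1) ^ j * B (Suc (2 * j)))))"
    unfolding sum_binomial_absorb_comp by simp
  also have "\<dots> = (\<Sum>j\<le>p. ?c j (D (2 * j)) + ?c j (D (2 * j + 1)) +
      2 * (real (p choose j) * (real (p - j) * ((-1) ^ j * D (2 * j + 1)))) +
      2 * (real (p choose j) * (real j * ((-1) ^ j * D (2 * real j - 1)))))"
    unfolding sum_distrib_left sum_subtractf[symmetric]
  proof (intro sum.cong refl)
    fix j assume "j \<in> {..p}"
    then have pj: "real (p - j) = real p - real j" by auto
    have "x * B (2 * j) - B (Suc (2 * j)) - 2 * ((real p - real j) * B (Suc (2 * j))) =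
        D (2 * j) + D (2 * j + 1) + 2 * ((real p - real j) * D (2 * j + 1)) + 2 * (real j * D (2 * real j - 1))"
      unfolding xB unfolding B by (simp add: algebra_simps)
    from arg_cong[OF this, of "?c j"]
    show "?c j (x * B (2 * j)) - ?c j (B (Suc (2 * j))) -
        2 * (real (p choose j) * (real (p - j) * ((-1) ^ j * B (Suc (2 * j))))) =
      ?c j (D (2 * j)) + ?c j (D (2 * j + 1)) +
      2 * (real (p choose j) * (real (p - j) * ((-1) ^ j * D (2 * j + 1)))) +
      2 * (real (p choose j) * (real j * ((-1) ^ j * D (2 * real j - 1))))"
      unfolding pj by (simp add: algebra_simps)
  qed
  also have "\<dots> = (\<Sum>j\<le>p. ?c j (D (2 * j))) + (\<Sum>j\<le>p. ?c j (D (2 * j + 1)))"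
  proof -
    \<comment> \<open>Absorbing the weights \<open>p - j\<close> and \<open>j\<close> gives the
      factor p and binomials of p - 1. In the second sum j is also shifted by one, which flips the
      sign and turns 2 j - 1 into 2 j + 1, so the sums cancel.\<close>
    have "(\<Sum>j\<le>p. real (p choose j) * (real (p - j) * ((-1) ^ j * D (2 * j + 1)))) +
        (\<Sum>j\<le>p. real (p choose j) * (real j * ((-1) ^ j * D (2 * real j - 1)))) = 0"
      unfolding sum_binomial_absorb_comp sum_binomial_absorb
      by (simp add: sum_negf algebra_simps)
    then show ?thesis by (simp add: sum.distrib flip: sum_distrib_left)
  qed
  also have "\<dots> = (\<Sum>k\<le>p. (p choose k) * (x + real (Suc p) - real k gchoose (Suc p + 1))) +
      (\<Sum>k\<le>p. (p choose k) * (x + real p - real k gchoose (Suc p + 1)))"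
  proof -
    have e: "p + 2 + p = 2 * p + 2" by simp
    show ?thesis
      using sum_alternating_gchoose[of p "x + real (2 * p + 1)" "p + 2", unfolded e]
        sum_alternating_gchoose[of p "x + real (2 * p)" "p + 2", unfolded e]
      by (simp add: D_def algebra_simps)
  qed
  also have "\<dots> = (\<Sum>k\<le>Suc p. (Suc p choose k) * (x + real (Suc p) - real k gchoose (Suc p + 1)))"
    unfolding sum_binomial_Suc by (simp add: sum.distrib distrib_left algebra_simps)
  finally show ?thesis .
qed

text \<open>The value does not involve \<open>\<alpha>\<close>, so a further sum over all matchings
  only multiplies it by their number. Since the sum of weights is known only after multiplication by
  x, a cancellation of x is needed.\<close>

lemma sum_cyclic_matching:
  fixes x :: real
  assumes fin: "finite U" and \<alpha>: "\<alpha> \<in> matchings U" and r: "r \<in> U"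
    and card: "card U = 2 * p + 2" and x: "x \<noteq> 0"
  shows "(\<Sum>t | t permutes U \<and> orbit t r = U. x ^ num_cycles U (\<alpha> \<circ> t)) =
    fact (2 * p + 1) * (\<Sum>k\<le>Suc p. (Suc p choose k) * ((x + real (Suc p) - real k) gchoose (Suc p + 1)))"
proof -
  let ?B = "\<lambda>k::nat. (x + real (2 * p + 1) - real k) gchoose (2 * p + 1)"
  have hook: "hook U x k = (-1) ^ k * (fact (2 * p + 1) * x) * ?B k" if "k \<le> 2 * p + 1" for k
    using pochhammer_hook[OF that, of x] by (simp add: hook_def[OF fin \<alpha>] card)
  have "x * (\<Sum>t | t permutes U \<and> orbit t r = U. x ^ num_cycles U (\<alpha> \<circ> t)) =
    x * (\<Sum>j\<le>p. (p choose j) * ((-1) ^ j * hook U x (2 * j))) +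
    (\<Sum>j\<le>p. (p choose j) * ((-1) ^ j * hook U x (Suc (2 * j)))) +
    2 * real p * (\<Sum>j\<le>p - 1. (p - 1 choose j) * ((-1) ^ j * hook U x (Suc (2 * j))))"
    unfolding sum_cyclic_eq_sum_weight[OF fin \<alpha> r] by (rule sum_weight[OF fin \<alpha> r card])
  also have "\<dots> = fact (2 * p + 1) * x * ((\<Sum>j\<le>p. (p choose j) * ((-1) ^ j * (x * ?B (2 * j)))) -
      (\<Sum>j\<le>p. (p choose j) * ((-1) ^ j * ?B (Suc (2 * j)))) -
      2 * real p * (\<Sum>j\<le>p - 1. (p - 1 choose j) * ((-1) ^ j * ?B (Suc (2 * j)))))"
    by (simp add: hook sum_distrib_left right_diff_distrib sum_negf algebra_simps del: fact_Suc cong: sum.cong_simp)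
  finally show ?thesis unfolding hook_sum using x by simp
qed

section \<open>Averaging over long cycles\<close>

lemma finite_matchings: "finite S \<Longrightarrow> finite (matchings S)"
  by (rule finite_subset[OF _ finite_permutations]) (auto simp: matchings_def)

lemma matchings_remove_pair:
  assumes "a \<in> S" "b \<in> S" "a \<noteq> b"
  shows "bij_betw (\<lambda>\<beta>. transpose a b \<circ> \<beta>) (matchings (S - {a, b})) {\<alpha> \<in> matchings S. \<alpha> a = b}"
proof (rule bij_betwI[where g = "\<lambda>\<alpha>. transpose a b \<circ> \<alpha>"])
  show "(\<lambda>\<beta>. transpose a b \<circ> \<beta>) \<in> matchings (S - {a, b}) \<rightarrow> {\<alpha> \<in> matchings S. \<alpha> a = b}"
  proof
    fix \<beta> assume "\<beta> \<in> matchings (S - {a, b})"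
    then have \<beta>: "\<beta> permutes (S - {a, b})" "\<forall>x\<in>S - {a, b}. \<beta> (\<beta> x) = x \<and> \<beta> x \<noteq> x"
      by (auto simp: matchings_def)
    then have ab: "\<beta> a = a" "\<beta> b = b" by (simp_all add: permutes_def)
    have "\<beta> permutes S" using \<beta>(1) by (rule permutes_subset) auto
    then have "transpose a b \<circ> \<beta> permutes S"
      using assms by (intro permutes_compose permutes_swap_id)
    moreover have "(transpose a b \<circ> \<beta>) ((transpose a b \<circ> \<beta>) x) = x \<and> (transpose a b \<circ> \<beta>) x \<noteq> x"
      if "x \<in> S" for x
    proof (cases "x \<in> {a, b}")
      case True
      then show ?thesis using ab assms by auto
    next
      case False
      then have "x \<in> S - {a, b}" using that by simp
      moreover from this have "\<beta> x \<in> S - {a, b}" using permutes_in_image[OF \<beta>(1)] by blast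
      ultimately show ?thesis using \<beta>(2) by (auto simp: transpose_def)
    qed
    ultimately show "transpose a b \<circ> \<beta> \<in> {\<alpha> \<in> matchings S. \<alpha> a = b}"
      using ab by (simp add: matchings_def)
  qed
  show "(\<lambda>\<alpha>. transpose a b \<circ> \<alpha>) \<in> {\<alpha> \<in> matchings S. \<alpha> a = b} \<rightarrow> matchings (S - {a, b})"
  proof
    fix \<alpha> assume "\<alpha> \<in> {\<alpha> \<in> matchings S. \<alpha> a = b}"
    then have \<alpha>: "\<alpha> permutes S" "\<forall>x\<in>S. \<alpha> (\<alpha> x) = x \<and> \<alpha> x \<noteq> x" "\<alpha> a = b"
      by (auto simp: matchings_def)
    then have ba: "\<alpha> b = a" using assms by metis
    have "transpose a b \<circ> \<alpha> permutes S"
      using assms \<alpha> by (intro permutes_compose permutes_swap_id)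
    then have "transpose a b \<circ> \<alpha> permutes (S - {a, b})"
      by (rule permutes_superset) (use \<alpha> ba in auto)
    moreover have "(transpose a b \<circ> \<alpha>) ((transpose a b \<circ> \<alpha>) x) = x \<and> (transpose a b \<circ> \<alpha>) x \<noteq> x"
      if x: "x \<in> S - {a, b}" for x
    proof -
      have "\<alpha> x \<noteq> a" "\<alpha> x \<noteq> b" using \<alpha> ba x by (metis DiffE insertCI)+
      then show ?thesis using \<alpha>(2) x by simp
    qed
    ultimately show "transpose a b \<circ> \<alpha> \<in> matchings (S - {a, b})" by (simp add: matchings_def)
  qed
qed (simp_all add: fun_eq_iff)

text \<open>For n > 0 a chosen point has 2 n - 1 possible partners, whence (2 n - 1)!! matchings;
  denominators are cleared to stay in the natural numbers.\<close>

lemma card_matchings: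
  assumes "finite S" "card S = 2 * n"
  shows "card (matchings S) * (2 ^ n * fact n) = (fact (2 * n) :: nat)"
  using assms
proof (induction n arbitrary: S)
  case 0
  then have "matchings S = {id}" by (auto simp: matchings_def)
  then show ?case by simp
next
  case (Suc n)
  then have "S \<noteq> {}" by auto
  then obtain a where a: "a \<in> S" by blast
  have IH: "card {\<alpha> \<in> matchings S. \<alpha> a = b} * (2 ^ n * fact n) = fact (2 * n)" if b: "b \<in> S - {a}" for b
  proof -
    have "card (S - {a, b}) = 2 * n"
      using Suc.prems a b by (subst card_Diff_subset) auto
    then have "card (matchings (S - {a, b})) * (2 ^ n * fact n) = fact (2 * n)"
      using Suc by simp
    then show ?thesis
      using bij_betw_same_card[OF matchings_remove_pair[of a S b]] a b by auto
  qed
  have "matchings S = (\<Union>b\<in>S - {a}. {\<alpha> \<in> matchings S. \<alpha> a = b})"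
    using a by (auto simp: matchings_def permutes_in_image)
  then have "card (matchings S) = card (\<Union>b\<in>S - {a}. {\<alpha> \<in> matchings S. \<alpha> a = b})"
    by (rule arg_cong)
  also have "\<dots> = (\<Sum>b\<in>S - {a}. card {\<alpha> \<in> matchings S. \<alpha> a = b})"
    using Suc.prems finite_matchings[OF Suc.prems(1)] by (intro card_UN_disjoint) auto
  finally have "card (matchings S) * (2 ^ n * fact n) =
      (\<Sum>b\<in>S - {a}. card {\<alpha> \<in> matchings S. \<alpha> a = b} * (2 ^ n * fact n))"
    by (simp add: sum_distrib_right)
  also have "\<dots> = (2 * n + 1) * fact (2 * n)"
    using IH Suc.prems a by (simp add: algebra_simps)
  finally have *: "card (matchings S) * (2 ^ n * fact n) = (2 * n + 1) * fact (2 * n)" .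
  have "card (matchings S) * (2 ^ Suc n * fact (Suc n)) =
      2 * Suc n * (card (matchings S) * (2 ^ n * fact n))"
    by (simp only: fact_Suc power_Suc of_nat_id ac_simps)
  also have "\<dots> = fact (2 * Suc n)" unfolding * by (simp add: algebra_simps)
  finally show ?case .
qed

section \<open>Conjugates of a long cycle\<close>

lemma bij_betw_funpow_orbit:
  assumes "p permutes U" "finite U" "orbit p r = U"
  shows "bij_betw (\<lambda>k. (p ^^ k) r) {0..<card U} U" "(p ^^ card U) r = r"
proof -
  have self: "r \<in> orbit p r"
    using assms permutation_self_in_orbit permutes_imp_permutation by metis
  have "bij_betw (\<lambda>k. (p ^^ k) r) {0..<funpow_dist1 p r r} U"
    using inj_on_funpow_dist1[OF self] orbit_conv_funpow_dist1[OF self] assms(3)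
    by (simp add: bij_betw_def)
  moreover from this have "card U = funpow_dist1 p r r" using bij_betw_same_card by fastforce
  ultimately show "bij_betw (\<lambda>k. (p ^^ k) r) {0..<card U} U" "(p ^^ card U) r = r"
    using funpow_dist1_prop[OF self] by simp_all
qed

text \<open>\<open>q\<close> matches the enumerations of \<open>U\<close> along the two cycles,
  sending \<open>(c ^^ k) r\<close> to \<open>(t ^^ k) r\<close>; in particular it fixes
  \<open>r\<close>.\<close>

lemma ex_conj_cyclic:
  assumes c: "c permutes U" "orbit c r = U" and t: "t permutes U" "orbit t r = U" and fin: "finite U"
  obtains q where "q permutes (U - {r})" "t = q \<circ> c \<circ> inv q"
proof -
  define m where "m = card U"
  note bc = bij_betw_funpow_orbit[OF c(1) fin c(2), folded m_def]
    and bt = bij_betw_funpow_orbit[OF t(1) fin t(2), folded m_def]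
  define g where "g = inv_into {0..<m} (\<lambda>k. (c ^^ k) r)"
  define q where "q x = (if x \<in> U then (t ^^ g x) r else x)" for x
  have "r \<in> U" using c permutation_self_in_orbit permutes_imp_permutation fin by metis
  then have m: "m > 0" unfolding m_def using fin by (auto simp: card_gt_0_iff)
  have g: "bij_betw g U {0..<m}" unfolding g_def by (rule bij_betw_inv_into[OF bc(1)])
  have "bij_betw ((\<lambda>k. (t ^^ k) r) \<circ> g) U U" by (rule bij_betw_trans[OF g bt(1)])
  then have "bij_betw q U U" by (rule bij_betw_cong[THEN iffD1, rotated]) (simp add: q_def)
  then have qU: "q permutes U" by (rule bij_imp_permutes) (simp add: q_def)
  have cU: "(c ^^ k) r \<in> U" for k using \<open>r \<in> U\<close> by (induction k) (simp_all add: permutes_in_image[OF c(1)])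
  have qc: "q ((c ^^ k) r) = (t ^^ k) r" if "k < m" for k
  proof -
    have "g ((c ^^ k) r) = k" unfolding g_def
      using that bc(1) by (intro inv_into_f_f) (auto simp: bij_betw_def)
    then show ?thesis using cU by (simp add: q_def)
  qed
  have qr: "q r = r" using qc[of 0] m by simp
  have comm: "q (c x) = t (q x)" for x
  proof (cases "x \<in> U")
    case True
    then obtain k where k: "k < m" "x = (c ^^ k) r" using bc(1) by (auto simp: bij_betw_def)
    show ?thesis
    proof (cases "Suc k < m")
      case True
      then show ?thesis using qc[of "Suc k"] qc[of k] k by simp
    next
      case False
      \<comment> \<open>The enumeration wraps around here: both cycles return to \<open>r\<close>
        after m steps.\<close>
      then have "m = Suc k" using k by simp
      then show ?thesis using bc(2) bt(2) qc[of k] k qr by simp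
    qed
  next
    case False
    then have "q x = x" by (simp add: q_def)
    moreover have "c x = x" "t x = x" using False c t by (simp_all add: permutes_def)
    ultimately show ?thesis by simp
  qed
  show thesis
  proof
    show "q permutes (U - {r})" using qU by (rule permutes_superset) (use qr in auto)
    show "t = q \<circ> c \<circ> inv q" by (simp add: fun_eq_iff comm permutes_inverses[OF qU])
  qed
qed

text \<open>Conjugating \<open>c\<close> by the permutations that fix \<open>r\<close> gives every
  single cycle exactly once: a conjugator exists by \<open>ex_conj_cyclic\<close>, and it is
  determined on every \<open>(c ^^ k) r\<close>.\<close>

lemma sum_cyclic_conj_invariant:
  fixes F :: "('a \<Rightarrow> 'a) \<Rightarrow> real"
  assumes c: "c permutes U" "orbit c r = U" and fin: "finite U"
    and inv: "\<And>q. q permutes U \<Longrightarrow> F (q \<circ> c \<circ> inv q) = F c"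
  shows "(\<Sum>t | t permutes U \<and> orbit t r = U. F t) = fact (card U - 1) * F c"
proof -
  have r: "r \<in> U" using c permutation_self_in_orbit permutes_imp_permutation fin by metis
  have conj: "((q \<circ> c \<circ> inv q) ^^ k) r = q ((c ^^ k) r)" if "q permutes (U - {r})" for q k
  proof -
    have "inv q r = r" using that by (simp add: permutes_inv_eq[OF that] permutes_def)
    moreover have "((q \<circ> c \<circ> inv q) ^^ k) (q r) = q ((c ^^ k) r)"
      by (induction k) (auto simp: permutes_inverses[OF that])
    ultimately show ?thesis using that by (simp add: permutes_def)
  qed
  have U: "U = {(c ^^ k) r |k. 0 < k}" using c(2) by (simp add: orbit_altdef)
  have "bij_betw (\<lambda>q. q \<circ> c \<circ> inv q) {q. q permutes (U - {r})} {t. t permutes U \<and> orbit t r = U}"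
    unfolding bij_betw_def
  proof
    show "inj_on (\<lambda>q. q \<circ> c \<circ> inv q) {q. q permutes (U - {r})}"
    proof (rule inj_onI)
      fix p q assume pq: "p \<in> {q. q permutes (U - {r})}" "q \<in> {q. q permutes (U - {r})}"
        and eq: "p \<circ> c \<circ> inv p = q \<circ> c \<circ> inv q"
      have "p x = q x" for x
      proof (cases "x \<in> U")
        case True
        then obtain k where "x = (c ^^ k) r" using U by blast
        then show ?thesis using conj[of p k] conj[of q k] pq eq by simp
      next
        case False
        then show ?thesis using pq by (simp add: permutes_def)
      qed
      then show "p = q" by auto
    qed
    show "(\<lambda>q. q \<circ> c \<circ> inv q) ` {q. q permutes (U - {r})} = {t. t permutes U \<and> orbit t r = U}"
    proof (intro equalityI subsetI)
      fix t assume "t \<in> (\<lambda>q. q \<circ> c \<circ> inv q) ` {q. q permutes (U - {r})}"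
      then obtain q where q: "q permutes (U - {r})" and t: "t = q \<circ> c \<circ> inv q" by auto
      have qU: "q permutes U" using q by (rule permutes_subset) auto
      have "t permutes U" unfolding t using c qU by (intro permutes_compose permutes_inv)
      moreover have "orbit t r = q ` U"
        unfolding U by (auto simp: orbit_altdef t conj[OF q])
      ultimately show "t \<in> {t. t permutes U \<and> orbit t r = U}"
        using permutes_image[OF qU] by simp
    next
      fix t assume "t \<in> {t. t permutes U \<and> orbit t r = U}"
      then show "t \<in> (\<lambda>q. q \<circ> c \<circ> inv q) ` {q. q permutes (U - {r})}"
        using ex_conj_cyclic[OF c _ _ fin, of t] by blast
    qed
  qed
  from sum.reindex_bij_betw[OF this, of F, symmetric]
  have "(\<Sum>t | t permutes U \<and> orbit t r = U. F t) = (\<Sum>q | q permutes (U - {r}). F (q \<circ> c \<circ> inv q))" .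
  also have "\<dots> = (\<Sum>q | q permutes (U - {r}). F c)"
    by (intro sum.cong refl inv) (auto elim: permutes_subset)
  also have "\<dots> = fact (card U - 1) * F c"
    using fin r card_permutations[of "U - {r}" "card U - 1"] by simp
  finally show ?thesis .
qed

lemma matchings_conj:
  assumes q: "q permutes U" and \<alpha>: "\<alpha> \<in> matchings U"
  shows "q \<circ> \<alpha> \<circ> inv q \<in> matchings U"
proof -
  have "q \<circ> \<alpha> \<circ> inv q permutes U"
    using q \<alpha> by (intro permutes_compose permutes_inv) (auto simp: matchings_def)
  moreover have "inv q x \<in> U" if "x \<in> U" for x
    using that permutes_in_image[OF permutes_inv[OF q]] by simp
  moreover have "q (\<alpha> (inv q x)) \<noteq> x" if "\<alpha> (inv q x) \<noteq> inv q x" for x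
    using that permutes_inv_eq[OF q, of x] by metis
  ultimately show ?thesis
    using \<alpha> by (simp add: matchings_def permutes_inverses[OF q])
qed

text \<open>Double counting of pairs of a matching and a single cycle: the sum over matchings is the
  same for each of the (2 n - 1)! cycles, the sum over cycles is the same for each matching and
  carries the factor (2 n - 1)!, which cancels.\<close>

lemma sum_matchings_cyclic:
  fixes x :: real
  assumes fin: "finite U" and card: "card U = 2 * n" and n: "n > 0"
    and c: "c permutes U" "orbit c r = U"
    and x: "x \<noteq> 0"
  shows "(\<Sum>\<alpha>\<in>matchings U. x ^ num_cycles U (\<alpha> \<circ> c)) =
    fact (2 * n) / (2 ^ n * fact n) * (\<Sum>k\<le>n. (n choose k) * ((x + real n - real k) gchoose (n + 1)))"
proof -
  define F where "F t = (\<Sum>\<alpha>\<in>matchings U. x ^ num_cycles U (\<alpha> \<circ> t))" for t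
  have r: "r \<in> U" using c permutation_self_in_orbit permutes_imp_permutation fin by metis
  obtain p where p: "n = Suc p" using n by (cases n) auto
  \<comment> \<open>Conjugating the cycle is undone by conjugating the matching, which only permutes
    the summands.\<close>
  have inv: "F (q \<circ> c \<circ> inv q) = F c" if q: "q permutes U" for q
    unfolding F_def
  proof (rule sum.reindex_bij_witness[where j = "\<lambda>\<alpha>. inv q \<circ> \<alpha> \<circ> q" and i = "\<lambda>\<alpha>. q \<circ> \<alpha> \<circ> inv q"])
    fix \<alpha> assume \<alpha>: "\<alpha> \<in> matchings U"
    show "inv q \<circ> \<alpha> \<circ> q \<in> matchings U"
      using matchings_conj[OF permutes_inv[OF q] \<alpha>] by (simp add: permutes_inv_inv[OF q])
    show "q \<circ> \<alpha> \<circ> inv q \<in> matchings U" by (rule matchings_conj[OF q \<alpha>])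
    show "q \<circ> (inv q \<circ> \<alpha> \<circ> q) \<circ> inv q = \<alpha>" "inv q \<circ> (q \<circ> \<alpha> \<circ> inv q) \<circ> q = \<alpha>"
      by (simp_all add: fun_eq_iff permutes_inverses[OF q])
    have "q \<circ> (inv q \<circ> \<alpha> \<circ> q \<circ> c) \<circ> inv q = \<alpha> \<circ> (q \<circ> c \<circ> inv q)"
      by (simp add: fun_eq_iff permutes_inverses[OF q])
    then show "x ^ num_cycles U (inv q \<circ> \<alpha> \<circ> q \<circ> c) = x ^ num_cycles U (\<alpha> \<circ> (q \<circ> c \<circ> inv q))"
      using num_cycles_conj[OF q, of "inv q \<circ> \<alpha> \<circ> q \<circ> c"] by simp
  qed
  let ?R = "\<Sum>k\<le>n. (n choose k) * ((x + real n - real k) gchoose (n + 1))"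
  have "fact (2 * p + 1) * F c = (\<Sum>t | t permutes U \<and> orbit t r = U. F t)"
    using sum_cyclic_conj_invariant[OF c fin, of F] inv card p by simp
  also have "\<dots> = (\<Sum>\<alpha>\<in>matchings U. \<Sum>t | t permutes U \<and> orbit t r = U. x ^ num_cycles U (\<alpha> \<circ> t))"
    unfolding F_def by (rule sum.swap)
  also have "\<dots> = (\<Sum>\<alpha>\<in>matchings U. fact (2 * p + 1) * ?R)"
    unfolding p using card p by (intro sum.cong refl sum_cyclic_matching fin r x) simp_all
  finally have "F c = card (matchings U) * ?R" by simp
  moreover have "real (card (matchings U)) = fact (2 * n) / (2 ^ n * fact n)"
    using arg_cong[OF card_matchings[OF fin card], of real] by (simp add: field_simps)
  ultimately show ?thesis by (simp add: F_def)
qed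

section \<open>Generating functions\<close>

lemma long_cycle_permutes: "long_cycle n permutes {1..2 * n}"
proof -
  have "set [1..<2 * n + 1] = {1..2 * n}" by auto
  then show ?thesis using cycle_permutes[of "[1..<2 * n + 1]"] by (simp add: long_cycle_def)
qed

lemma funpow_long_cycle:
  assumes "k < 2 * n"
  shows "(long_cycle n ^^ k) 1 = Suc k"
proof -
  let ?cs = "[1..<2 * n + 1]"
  have "map (long_cycle n ^^ k) ?cs ! 0 = rotate k ?cs ! 0"
    unfolding long_cycle_def by (subst cyclic_rotation) simp_all
  also have "\<dots> = Suc k" using assms by (subst nth_rotate) (auto simp del: upt_Suc)
  finally show ?thesis using assms by (simp add: nth_map del: upt_Suc)
qed

lemma orbit_long_cycle:
  assumes "n > 0"
  shows "orbit (long_cycle n) 1 = {1..2 * n}"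
proof
  show "orbit (long_cycle n) 1 \<subseteq> {1..2 * n}"
    using permutes_orbit_subset[OF long_cycle_permutes, of 1 n] assms by simp
  have "permutation (long_cycle n)"
    by (rule permutes_imp_permutation[OF _ long_cycle_permutes]) simp
  then have orb: "orbit (long_cycle n) 1 = {(long_cycle n ^^ k) 1 |k. True}"
    by (rule orbit_altdef_permutation)
  show "{1..2 * n} \<subseteq> orbit (long_cycle n) 1"
  proof
    fix y assume "y \<in> {1..2 * n}"
    then have "y = (long_cycle n ^^ (y - 1)) 1" by (subst funpow_long_cycle) auto
    then show "y \<in> orbit (long_cycle n) 1" unfolding orb by blast
  qed
qed

text \<open>A relabelling that commutes with the long cycle and fixes 1 fixes every point reached
  from 1, so all classes are singletons.\<close>

lemma map_equiv_eq_Id: "map_equiv n = Id_on (rooted_one_face_maps n)"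
proof -
  have id: "q = id" if q: "q permutes {1..2 * n}" "q 1 = 1"
    and conj: "long_cycle n = q \<circ> long_cycle n \<circ> inv q" for q
  proof -
    have step: "q (long_cycle n y) = long_cycle n (q y)" for y
      by (subst (2) conj) (simp add: permutes_inverses[OF q(1)])
    have "q ((long_cycle n ^^ k) 1) = (long_cycle n ^^ k) 1" for k
      by (induction k) (simp_all add: q(2)[unfolded One_nat_def] step)
    then have "q (Suc k) = Suc k" if "k < 2 * n" for k
      using funpow_long_cycle[OF that] by metis
    then have "q y = y" for y
      using q(1) by (cases "y \<in> {1..2 * n}"; cases y) (auto simp: permutes_def)
    then show ?thesis by auto
  qed
  show ?thesis
  proof (intro equalityI subsetI)
    fix MM assume "MM \<in> map_equiv n"
    then obtain \<alpha> \<beta> \<gamma> \<alpha>' \<beta>' \<gamma>' q where MM: "MM = ((\<alpha>, \<beta>, \<gamma>), (\<alpha>', \<beta>', \<gamma>'))"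
      and rooted: "(\<alpha>, \<beta>, \<gamma>) \<in> rooted_one_face_maps n" "(\<alpha>', \<beta>', \<gamma>') \<in> rooted_one_face_maps n"
      and q: "q permutes {1..2 * n}" "q 1 = 1"
        "\<alpha>' = q \<circ> \<alpha> \<circ> inv q" "\<gamma>' = q \<circ> \<gamma> \<circ> inv q"
      unfolding map_equiv_def by blast
    have \<gamma>: "\<gamma> = long_cycle n" "\<gamma>' = long_cycle n" "\<gamma> = \<alpha> \<circ> \<beta>" "\<gamma>' = \<alpha>' \<circ> \<beta>'" "\<alpha> permutes {1..2 * n}"
      using rooted by (auto simp: rooted_one_face_maps_def)
    have "q = id" using id q \<gamma> by metis
    then have "\<alpha>' = \<alpha>" using q by simp
    moreover from this have "\<beta>' = \<beta>" using \<gamma> permutes_inv_o(2)[OF \<gamma>(5)] by (metis comp_assoc id_comp)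
    ultimately show "MM \<in> Id_on (rooted_one_face_maps n)" using rooted \<gamma> MM by auto
  next
    fix MM assume "MM \<in> Id_on (rooted_one_face_maps n)"
    then obtain \<alpha> \<beta> \<gamma> where "MM = ((\<alpha>, \<beta>, \<gamma>), (\<alpha>, \<beta>, \<gamma>))" "(\<alpha>, \<beta>, \<gamma>) \<in> rooted_one_face_maps n"
      by (metis Id_onE prod_cases3)
    moreover have "\<exists>q. q permutes {1..2 * n} \<and> q 1 = 1 \<and> \<alpha> = q \<circ> \<alpha> \<circ> inv q \<and> \<gamma> = q \<circ> \<gamma> \<circ> inv q"
      by (rule exI[of _ id]) simp
    ultimately show "MM \<in> map_equiv n" by (simp add: map_equiv_def)
  qed
qed

lemma A_eq_card: "A n g = card {M \<in> rooted_one_face_maps n. has_genus n M g}"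
proof -
  let ?X = "{M \<in> rooted_one_face_maps n. has_genus n M g}"
  have "?X // map_equiv n = (\<lambda>M. {M}) ` ?X"
    by (auto simp: quotient_def map_equiv_eq_Id Id_on_def)
  then show ?thesis unfolding A_def by (simp add: card_image)
qed

text \<open>Since \<open>\<alpha>\<close> is an involution, \<gamma> = \<alpha>\<beta> means \<beta>
  = \<alpha>\<gamma>: a map is just a matching, and for n > 0 its vertices are the cycles of
  \<open>\<alpha> \<circ> long_cycle n\<close>.\<close>

lemma rooted_one_face_maps_eq:
  "rooted_one_face_maps n = (\<lambda>\<alpha>. (\<alpha>, \<alpha> \<circ> long_cycle n, long_cycle n)) ` matchings {1..2 * n}"
proof (intro equalityI subsetI)
  fix M assume "M \<in> rooted_one_face_maps n"
  then obtain \<alpha> \<beta> where M: "M = (\<alpha>, \<beta>, long_cycle n)" "\<alpha> permutes {1..2 * n}"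
    "\<forall>x\<in>{1..2 * n}. \<alpha> (\<alpha> x) = x \<and> \<alpha> x \<noteq> x" "long_cycle n = \<alpha> \<circ> \<beta>"
    by (auto simp: rooted_one_face_maps_def)
  then have \<alpha>: "\<alpha> \<in> matchings {1..2 * n}" by (simp add: matchings_def)
  have "\<alpha> (\<alpha> y) = y" for y
    using M(2,3) by (cases "y \<in> {1..2 * n}") (auto simp: permutes_def)
  then have "\<beta> = \<alpha> \<circ> long_cycle n" by (simp add: M(4) fun_eq_iff)
  then show "M \<in> (\<lambda>\<alpha>. (\<alpha>, \<alpha> \<circ> long_cycle n, long_cycle n)) ` matchings {1..2 * n}"
    using \<alpha> M(1) by blast
next
  fix M assume "M \<in> (\<lambda>\<alpha>. (\<alpha>, \<alpha> \<circ> long_cycle n, long_cycle n)) ` matchings {1..2 * n}"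
  then obtain \<alpha> where \<alpha>: "\<alpha> \<in> matchings {1..2 * n}"
    and M: "M = (\<alpha>, \<alpha> \<circ> long_cycle n, long_cycle n)" by blast
  have perm: "\<alpha> permutes {1..2 * n}" using \<alpha> by (simp add: matchings_def)
  have "\<alpha> (\<alpha> y) = y" for y
    using \<alpha> perm by (cases "y \<in> {1..2 * n}") (auto simp: permutes_def matchings_def)
  then have "long_cycle n = \<alpha> \<circ> (\<alpha> \<circ> long_cycle n)" by (simp add: fun_eq_iff)
  moreover have "\<alpha> \<circ> long_cycle n permutes {1..2 * n}"
    using perm long_cycle_permutes by (intro permutes_compose)
  ultimately show "M \<in> rooted_one_face_maps n"
    using \<alpha> perm unfolding M rooted_one_face_maps_def by (simp add: matchings_def)
qed

lemma finite_rooted_one_face_maps: "finite (rooted_one_face_maps n)"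
  by (simp add: rooted_one_face_maps_eq finite_matchings)

text \<open>The exponent is v + 1 for v vertices: the extra x offsets the division by x when
  binomial coefficients become rising factorials again, and v + 1 = n + 2 - 2 g is the value of i +
  j in the theorem.\<close>

lemma sum_rooted_one_face_maps:
  fixes x :: real
  shows "(\<Sum>M\<in>rooted_one_face_maps n. x ^ Suc (num_vertices n M)) =
    fact (2 * n) / (2 ^ n * fact n * fact (n + 1)) *
    (\<Sum>k\<le>n. (n choose k) * (pochhammer x (n - k + 1) * ((-1) ^ (k + 1) * pochhammer (- x) (k + 1))))"
proof (cases "n = 0 \<or> x = 0")
  case True
  \<comment> \<open>At x = 0, excluded in \<open>sum_matchings_cyclic\<close>, both sides vanish.
    For n = 0 the only map has one vertex by convention, and both sides are x^2.\<close>
  have "rooted_one_face_maps 0 = {(id, long_cycle 0, long_cycle 0)}"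
    by (auto simp: rooted_one_face_maps_eq matchings_def)
  then show ?thesis using True
    by (cases "n = 0") (auto simp: num_vertices_def power2_eq_square pochhammer_rec)
next
  case False
  then have n: "n > 0" and x: "x \<noteq> 0" by auto
  have inj: "inj_on (\<lambda>\<alpha>. (\<alpha>, \<alpha> \<circ> long_cycle n, long_cycle n)) (matchings {1..2 * n})"
    by (auto simp: inj_on_def)
  have "(\<Sum>M\<in>rooted_one_face_maps n. x ^ Suc (num_vertices n M)) =
      x * (\<Sum>\<alpha>\<in>matchings {1..2 * n}. x ^ num_cycles {1..2 * n} (\<alpha> \<circ> long_cycle n))"
    unfolding rooted_one_face_maps_eq sum.reindex[OF inj]
    using n by (simp add: num_vertices_def sum_distrib_left)
  also have "(\<Sum>\<alpha>\<in>matchings {1..2 * n}. x ^ num_cycles {1..2 * n} (\<alpha> \<circ> long_cycle n)) =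
      fact (2 * n) / (2 ^ n * fact n) * (\<Sum>k\<le>n. (n choose k) * ((x + real n - real k) gchoose (n + 1)))"
    using n by (intro sum_matchings_cyclic[where r = 1] long_cycle_permutes orbit_long_cycle x) auto
  \<comment> \<open>\<open>pochhammer_hook\<close> read backwards, with N = n + 1 and k + 1 for k;
    this is where (n + 1)! enters.\<close>
  also have "(\<Sum>k\<le>n. (n choose k) * ((x + real n - real k) gchoose (n + 1))) =
      (\<Sum>k\<le>n. (n choose k) * (pochhammer x (n - k + 1) * ((-1) ^ (k + 1) * pochhammer (- x) (k + 1)))) /
        (x * fact (n + 1))"
    unfolding sum_divide_distrib
  proof (intro sum.cong refl)
    fix k assume "k \<in> {..n}"
    then have k: "k + 1 \<le> n + 1" by simp
    have e: "Suc (n + 1) - (k + 1) = n - k + 1" using k by simp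
    have "pochhammer x (n - k + 1) * ((-1) ^ (k + 1) * pochhammer (- x) (k + 1)) =
        (-1) ^ (k + 1) * (pochhammer (- x) (k + 1) * pochhammer x (n - k + 1))" by simp
    also have "\<dots> = x * fact (n + 1) * ((x + real n - real k) gchoose (n + 1))"
    proof -
      have "(-1) ^ (k + 1) * ((-1) ^ (k + 1) * c) = c" for c :: real
        by (cases "even k") simp_all
      moreover have "x + real (n + 1) - real (k + 1) = x + real n - real k" by simp
      ultimately show ?thesis
        unfolding pochhammer_hook[OF k, of x, unfolded e] by (simp only: mult.assoc)
    qed
    finally show "(n choose k) * ((x + real n - real k) gchoose (n + 1)) =
        (n choose k) * (pochhammer x (n - k + 1) * ((-1) ^ (k + 1) * pochhammer (- x) (k + 1))) /
          (x * fact (n + 1))"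
      using x by simp
  qed
  finally show ?thesis using x by simp
qed

section \<open>Stirling polynomials and comparison of coefficients\<close>

definition cycle_poly :: "nat \<Rightarrow> real poly" where
  "cycle_poly m = (\<Sum>p | p permutes {1..m}. monom 1 (num_cycles {1..m} p))"

text \<open>The falling factorial x (x - 1) ... (x - m + 1). Its signs are (-1)^(m - j); the
  exponent m + j has the same parity and avoids truncated subtraction.\<close>

definition signed_cycle_poly :: "nat \<Rightarrow> real poly" where
  "signed_cycle_poly m = (\<Sum>p | p permutes {1..m}. monom ((-1) ^ (m + num_cycles {1..m} p)) (num_cycles {1..m} p))"

lemma poly_cycle_poly: "poly (cycle_poly m) x = pochhammer x m"
  using sum_power_num_cycles[of "{1..m}" x] by (simp add: cycle_poly_def poly_sum poly_monom)

lemma poly_signed_cycle_poly: "poly (signed_cycle_poly m) x = (-1) ^ m * pochhammer (- x) m"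
proof -
  have "poly (signed_cycle_poly m) x = (\<Sum>p | p permutes {1..m}. (-1) ^ m * (- x) ^ num_cycles {1..m} p)"
    unfolding signed_cycle_poly_def poly_sum poly_monom
    by (intro sum.cong refl) (simp add: power_add power_minus[of x])
  then show ?thesis
    using sum_power_num_cycles[of "{1..m}" "- x"] by (simp flip: sum_distrib_left)
qed

lemma coeff_cycle_poly: "coeff (cycle_poly m) i = perms_with_cycles m i"
proof -
  have "finite {p. p permutes {1..m}}" by (simp add: finite_permutations)
  then show ?thesis
    by (simp add: cycle_poly_def coeff_sum perms_with_cycles_def sum.If_cases Collect_conj_eq[symmetric])
qed

lemma coeff_signed_cycle_poly:
  "coeff (signed_cycle_poly m) j = (-1) ^ (m + j) * real (perms_with_cycles m j)"
proof -
  have "finite {p. p permutes {1..m}}" by (simp add: finite_permutations)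
  moreover have "coeff (signed_cycle_poly m) j =
      (\<Sum>p | p permutes {1..m}. if num_cycles {1..m} p = j then (-1) ^ (m + j) else 0)"
    unfolding signed_cycle_poly_def coeff_sum by (intro sum.cong refl) auto
  ultimately show ?thesis
    by (simp add: perms_with_cycles_def sum.If_cases Collect_conj_eq[symmetric])
qed

text \<open>The inner sum over i + j = N is the convolution that gives the coefficient of x^N in a
  product.\<close>

lemma A_bar_eq_coeff:
  assumes "int N = int n + 2 - 2 * int g"
  shows "A_bar n g = coeff (\<Sum>k\<le>n. smult (n choose k) (cycle_poly (n - k + 1) * signed_cycle_poly (k + 1))) N"
proof -
  have "(\<Sum>(i, j) \<in> {(i, j). int i + int j = int n + 2 - 2 * int g}.
      real (perms_with_cycles (n - k + 1) i) * (-1) powi (int k + 1 - int j) *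
      real (perms_with_cycles (k + 1) j)) =
    coeff (cycle_poly (n - k + 1) * signed_cycle_poly (k + 1)) N" for k
  proof -
    have powi: "(-1 :: real) powi (int k + 1 - int j) = (-1) ^ (k + 1 + j)" for j
    proof -
      have "(-1 :: real) powi (int (k + 1) - int j) = (-1) ^ (k + 1) / (-1) ^ j"
        by (subst power_int_diff) (simp_all only: power_int_of_nat, simp)
      then show ?thesis by (cases "even j") (simp_all add: power_add add.commute)
    qed
    have pairs: "{(i, j). int i + int j = int n + 2 - 2 * int g} = (\<lambda>i. (i, N - i)) ` {..N}"
      using assms by (auto simp: image_iff)
    show ?thesis
      unfolding pairs coeff_mult coeff_cycle_poly coeff_signed_cycle_poly
      by (subst sum.reindex) (auto simp: inj_on_def powi mult.assoc simp del: power_Suc)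
  qed
  then show ?thesis by (simp add: A_bar_def coeff_sum atLeast0AtMost)
qed

theorem theorem2p2:
  fixes n g :: nat
  shows "real (A n g) = fact (2 * n) / (2 ^ n * fact n * fact (n + 1)) * A_bar n g"
proof (cases "int n + 2 - 2 * int g < 0")
  case True
  then have no_pairs: "{(i, j). int i + int j = int n + 2 - 2 * int g} = {}" by auto
  \<comment> \<open>A map of genus g would have v + 1 = n + 2 - 2 g < 0 for its number v of
    vertices.\<close>
  have "{M \<in> rooted_one_face_maps n. has_genus n M g} = {}"
    using True by (auto simp: has_genus_def)
  then have "A n g = 0" by (simp only: A_eq_card card.empty)
  moreover have "A_bar n g = 0" unfolding A_bar_def no_pairs by simp
  ultimately show ?thesis by simp
next
  case False
  then obtain N where N: "int N = int n + 2 - 2 * int g"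
    using nonneg_int_cases by (metis not_le)
  let ?V = "\<Sum>M\<in>rooted_one_face_maps n. monom 1 (Suc (num_vertices n M)) :: real poly"
  let ?C = "\<Sum>k\<le>n. smult (n choose k) (cycle_poly (n - k + 1) * signed_cycle_poly (k + 1))"
  have "poly ?V x = poly (smult (fact (2 * n) / (2 ^ n * fact n * fact (n + 1))) ?C) x" for x
    using sum_rooted_one_face_maps[of x n]
    by (simp only: poly_sum poly_monom poly_smult poly_mult poly_cycle_poly poly_signed_cycle_poly mult_1)
  \<comment> \<open>Real polynomials that agree at every point are equal.\<close>
  then have "?V = smult (fact (2 * n) / (2 ^ n * fact n * fact (n + 1))) ?C"
    by (intro poly_eq_poly_eq_iff[THEN iffD1] ext)
  then have "coeff ?V N = fact (2 * n) / (2 ^ n * fact n * fact (n + 1)) * A_bar n g"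
    unfolding A_bar_eq_coeff[OF N] by (simp only: coeff_smult)
  moreover have "coeff ?V N = A n g"
  proof -
    have "has_genus n M g \<longleftrightarrow> Suc (num_vertices n M) = N" for M
      using N unfolding has_genus_def by linarith
    then show ?thesis
      using finite_rooted_one_face_maps[of n]
      by (simp add: A_eq_card coeff_sum flip: sum.inter_filter)
  qed
  ultimately show ?thesis by simp
qed

end
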